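(* Let $\{X_t\}_{t\in\mathbb Z}$ be a real-valued stationary time series with distribution $P$. Let $\{\mathcal B_k\}_{k\ge1}$ be an increasing sequence of finite subfields that asymptotically generate the Borel $\sigma$-field of $\mathbb R$, each $\mathcal B_k$ being generated by intervals, let $\{\ell_k\}_{k\ge1}$ and $\{J_k\}_{k\ge1}$ be nondecreasing unbounded sequences of positive integers, and let $\hat P_k(dx\mid X^{-\lambda_k})$ be the empirical conditional distributions defined in the context. Then for every bounded continuous function $h:\mathbb R\to\mathbb R$, $$\lim_{k\to\infty}\int h(x)\,\hat P_k(dx\mid X^{-\lambda_k})=\int h(x)\,P(dx\mid X^-)\quad\text{in } L^1(P).$$
   Context: Notation: $X=X_0$; $X^-=(\ldots,X_{-2},X_{-1})$ is the infinite past; $X^{-t}=(X_{-t},\ldots,X_{-1})$; $P(dx\mid X^-)$ is the regular conditional distribution of $X_0$ given $X^-$. "Asymptotically generate" means that $\sigma\big(\bigcup_k\mathcal B_k\big)$ is the Borel $\sigma$-field. For $x\in\mathbb R$, $[x]^k$ denotes the atom of $\mathcal B_k$ that contains $x$. Past recurrence times: for $k\ge1$ put $\tau^k_0=0$ and, for $j=1,2,\ldots$, $$\tau^k_j=\min\{t>\tau^k_{j-1}:\ ([X_{-\ell_k-t}]^k,\ldots,[X_{-1-t}]^k)=([X_{-\ell_k}]^k,\ldots,[X_{-1}]^k)\}.$$ These are finite almost surely by Poincaré's recurrence theorem. Put $\lambda_k=\ell_k+\tau^k_{J_k}$ and $$\hat P_k(dx\mid X^{-\lambda_k})=\frac1{J_k}\sum_{1\le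 j\le J_k}\delta_{X_{-\tau^k_j}}(dx),$$ where $\delta_\xi$ is the unit point mass at $\xi$. *)

theory Defs
  imports "HOL-Probability.Probability"
begin

definition is_atom :: "'a set set \<Rightarrow> 'a set \<Rightarrow> bool" where
  "is_atom B A \<longleftrightarrow> A \<in> B \<and> A \<noteq> {} \<and> (\<forall>C\<in>B. C \<subseteq> A \<longrightarrow> C = {} \<or> C = A)"

definition atom_of :: "'a set set \<Rightarrow> 'a \<Rightarrow> 'a set" where
  "atom_of B x = (THE A. is_atom B A \<and> x \<in> A)"

lemma atom_of_eq_Inter:
  assumes "algebra UNIV B" "finite B"
  shows "atom_of B x = \<Inter>{A \<in> B. x \<in> A}"
    and "is_atom B (atom_of B x)" and "x \<in> atom_of B x"
proof -
  interpret algebra UNIV B by fact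
  let ?I = "\<Inter>{A \<in> B. x \<in> A}"
  have in_B: "?I \<in> B"
    using \<open>finite B\<close> top by (intro finite_INT[of _ "\<lambda>A. A", simplified]) auto
  have atom: "is_atom B ?I"
    unfolding is_atom_def
  proof (intro conjI ballI impI in_B)
    show "?I \<noteq> {}" by blast
    fix C assume C: "C \<in> B" "C \<subseteq> ?I"
    show "C = {} \<or> C = ?I"
    proof (cases "x \<in> C")
      case True
      then show ?thesis using C by blast
    next
      case False
      then have "UNIV - C \<in> {A \<in> B. x \<in> A}" using C by auto
      then have "?I \<subseteq> UNIV - C" by blast
      then show ?thesis using C by blast
    qed
  qed
  have uniq: "A = ?I" if A: "is_atom B A" "x \<in> A" for A
  proof -
    have "A \<in> B" and min: "\<forall>C\<in>B. C \<subseteq> A \<longrightarrow> C = {} \<or> C = A"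
      using A(1) by (simp_all add: is_atom_def)
    have sub: "?I \<subseteq> A"
      by (rule Inter_lower) (simp add: \<open>A \<in> B\<close> A(2))
    have "x \<in> ?I" by simp
    then have "?I \<noteq> {}" by (metis empty_iff)
    with min[rule_format, OF in_B sub] show ?thesis by simp
  qed
  have x: "x \<in> ?I" by simp
  show eq: "atom_of B x = ?I"
    unfolding atom_of_def
    by (rule the_equality, rule conjI[OF atom x], erule conjE, rule uniq)
  show "is_atom B (atom_of B x)" "x \<in> atom_of B x"
    unfolding eq by (rule atom, rule x)
qed

text \<open>The block \<open>([x\<^bsub>-l-t\<^esub>], \<dots>, [x\<^bsub>-1-t\<^esub>])\<close> of atoms along a two-sided path \<open>x\<close>.\<close>

definition quantized_block :: "real set set \<Rightarrow> nat \<Rightarrow> (int \<Rightarrow> real) \<Rightarrow> nat \<Rightarrow> real set list" where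
  "quantized_block B l x t = map (\<lambda>i. atom_of B (x (i - int t))) [- int l..-1]"

text \<open>The infimum of a nonempty set of natural numbers is its minimum. Along a path with no
  further recurrence, the set is empty and its infimum is \<open>0\<close>; under stationarity such
  paths form a null set.\<close>

fun recurrence_time :: "real set set \<Rightarrow> nat \<Rightarrow> (int \<Rightarrow> real) \<Rightarrow> nat \<Rightarrow> nat" where
  "recurrence_time B l x 0 = 0"
| "recurrence_time B l x (Suc j) =
     Inf {t. t > recurrence_time B l x j \<and> quantized_block B l x t = quantized_block B l x 0}"

definition empirical_cond_dist :: "real set set \<Rightarrow> nat \<Rightarrow> nat \<Rightarrow> (int \<Rightarrow> real) \<Rightarrow> real measure" where
  "empirical_cond_dist B l J x =
     measure_of UNIV (sets borel)
       (\<lambda>A. ennreal (1 / real J) *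
            (\<Sum>j = 1..J. emeasure (return borel (x (- int (recurrence_time B l x j)))) A))"

lemma sets_empirical_cond_dist [simp, measurable_cong]:
  "sets (empirical_cond_dist B l J x) = sets borel"
  unfolding empirical_cond_dist_def
  by (simp add: sets.sigma_sets_eq[of borel, simplified])

lemma emeasure_empirical_cond_dist:
  assumes "A \<in> sets borel"
  shows "emeasure (empirical_cond_dist B l J x) A =
    ennreal (1 / real J) *
      (\<Sum>j = 1..J. emeasure (return borel (x (- int (recurrence_time B l x j)))) A)"
proof (rule emeasure_measure_of[OF empirical_cond_dist_def])
  let ?\<mu> = "\<lambda>A. ennreal (1 / real J) *
      (\<Sum>j = 1..J. emeasure (return borel (x (- int (recurrence_time B l x j)))) A)"
  show "sets borel \<subseteq> Pow (UNIV :: real set)" by simp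
  show "A \<in> sets (empirical_cond_dist B l J x)" using assms by simp
  show "positive (sets (empirical_cond_dist B l J x)) ?\<mu>" by (simp add: positive_def)
  show "countably_additive (sets (empirical_cond_dist B l J x)) ?\<mu>"
    unfolding countably_additive_def
  proof (intro allI impI)
    fix F :: "nat \<Rightarrow> real set"
    assume F: "range F \<subseteq> sets (empirical_cond_dist B l J x)" "disjoint_family F"
    have "(\<Sum>i. ?\<mu> (F i)) = ennreal (1 / real J) *
        (\<Sum>j = 1..J. \<Sum>i. emeasure (return borel (x (- int (recurrence_time B l x j)))) (F i))"
      by (simp add: suminf_sum)
    also have "\<dots> = ?\<mu> (\<Union> (range F))"
      using F by (intro arg_cong2[where f = "(*)"] sum.cong refl suminf_emeasure) auto
    finally show "(\<Sum>i. ?\<mu> (F i)) = ?\<mu> (\<Union> (range F))" .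
  qed
qed

definition stationary :: "'a measure \<Rightarrow> (int \<Rightarrow> 'a \<Rightarrow> real) \<Rightarrow> bool" where
  "stationary M X \<longleftrightarrow>
     (\<forall>s. distr M (\<Pi>\<^sub>M t\<in>UNIV. borel) (\<lambda>\<omega> t. X (t + s) \<omega>) =
          distr M (\<Pi>\<^sub>M t\<in>UNIV. borel) (\<lambda>\<omega> t. X t \<omega>))"

abbreviation past_algebra :: "(int \<Rightarrow> real) measure" where
  "past_algebra \<equiv> \<Pi>\<^sub>M t\<in>{..<0}. borel"

definition past :: "(int \<Rightarrow> 'a \<Rightarrow> real) \<Rightarrow> 'a \<Rightarrow> int \<Rightarrow> real" where
  "past X \<omega> = (\<lambda>t\<in>{..<0}. X t \<omega>)"

text \<open>\<open>\<kappa>\<close> is a regular version of the conditional distribution of the \<open>S\<close>-valued variable \<open>Z\<close>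
  given the \<open>T\<close>-valued variable \<open>Y\<close>, as a Markov kernel from \<open>T\<close> to \<open>S\<close>.\<close>

definition regular_cond_dist ::
  "'a measure \<Rightarrow> 'b measure \<Rightarrow> ('a \<Rightarrow> 'b) \<Rightarrow> 'c measure \<Rightarrow> ('a \<Rightarrow> 'c) \<Rightarrow> ('c \<Rightarrow> 'b measure) \<Rightarrow> bool" where
  "regular_cond_dist M S Z T Y \<kappa> \<longleftrightarrow>
     \<kappa> \<in> T \<rightarrow>\<^sub>M prob_algebra S \<and>
     (\<forall>A\<in>sets S. AE \<omega> in M. measure (\<kappa> (Y \<omega>)) A =
        real_cond_exp M (vimage_algebra (space M) Y T) (\<lambda>\<omega>. indicator A (Z \<omega>)) \<omega>)"

end

theory Submission
  imports Defs
begin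

text \<open>
  Fix a level \<open>k\<close> and let the return map \<open>R\<close> send a path to the path seen from the most recent
  recurrence of its quantized block. Almost surely recurrences exist, and \<open>R\<close> preserves the law of
  the process: like the induced map of ergodic theory, it permutes the paths that carry a given block,
  up to null sets
  (\<open>AE_recurrent\<close>, \<open>distr_return_map\<close>). The \<open>j\<close>-th recurrence is the \<open>j\<close>-th iterate of \<open>R\<close>, so the
  empirical mean of \<open>h\<close> is the average of \<open>h (x 0)\<close> along an orbit of \<open>R\<close> of length \<open>J k\<close>.

  Let \<open>F\<close> be the conditional mean of \<open>h (x 0)\<close> given the past and write \<open>h (x 0)\<close> as \<open>F\<close> plus an
  innovation. The innovation at the origin is orthogonal to the past, and the innovations at all earlier
  recurrences are functions of that past. By invariance under \<open>R\<close>, the innovations along the orbit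
  are therefore pairwise orthogonal, and their average is of order \<open>1 / sqrt (J k)\<close> in mean square
  (\<open>integral_abs_mean_innov_le\<close>).

  There remains the average of \<open>F\<close> along the orbit. A function \<open>g\<close> of the block is constant along the
  orbit, and by invariance replacing \<open>F\<close> by \<open>g\<close> costs at most twice the \<open>L\<^sup>1\<close> distance of \<open>F\<close> and
  \<open>g\<close> (\<open>integral_bias_le\<close>). Since the blocks generate the past, this distance can be made arbitrarily
  small by a function of the block at a single level (\<open>block_approximable_integrable\<close>), which is also a
  function of the block at every later level.
\<close>

section \<open>Shifts and quantized blocks\<close>

abbreviation paths :: "(int \<Rightarrow> real) measure" where
  "paths \<equiv> \<Pi>\<^sub>M t\<in>UNIV. borel"

definition time_shift :: "int \<Rightarrow> (int \<Rightarrow> real) \<Rightarrow> int \<Rightarrow> real" where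
  "time_shift s x = (\<lambda>t. x (t - s))"

lemma shift_0 [simp]: "time_shift 0 x = x"
  by (simp add: time_shift_def)

lemma shift_shift [simp]: "time_shift s (time_shift t x) = time_shift (s + t) x"
  by (simp add: time_shift_def algebra_simps)

lemma measurable_shift [measurable]: "time_shift s \<in> paths \<rightarrow>\<^sub>M paths"
  unfolding time_shift_def by (rule measurable_PiM_single') auto

lemma atom_of_eq_iff:
  assumes "algebra UNIV B" "finite B"
  shows "atom_of B a = atom_of B b \<longleftrightarrow> (\<forall>A\<in>B. a \<in> A \<longleftrightarrow> b \<in> A)"
proof
  assume eq: "atom_of B a = atom_of B b"
  have "u \<in> A" if "atom_of B u = atom_of B v" "A \<in> B" "v \<in> A" for u v A
    using atom_of_eq_Inter(3)[OF assms, of u] atom_of_eq_Inter(1)[OF assms, of v] that by auto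
  then show "\<forall>A\<in>B. a \<in> A \<longleftrightarrow> b \<in> A" using eq by metis
next
  assume "\<forall>A\<in>B. a \<in> A \<longleftrightarrow> b \<in> A"
  then have "{A \<in> B. a \<in> A} = {A \<in> B. b \<in> A}" by auto
  then show "atom_of B a = atom_of B b" by (simp add: atom_of_eq_Inter(1)[OF assms])
qed

text \<open>Reading a block further back along a path is reading it at the origin of the shifted path; so a
  recurrence of the block at the origin is a return of the shifted path to a set of paths.\<close>

lemma quantized_block_shift: "quantized_block B l (time_shift (int s) x) t = quantized_block B l x (t + s)"
  by (simp add: quantized_block_def time_shift_def algebra_simps)

lemma quantized_block_eq_iff:
  assumes "algebra UNIV B" "finite B"
  shows "quantized_block B l x s = quantized_block B l y t \<longleftrightarrow>
    (\<forall>i\<in>{- int l..-1}. \<forall>A\<in>B. x (i - int s) \<in> A \<longleftrightarrow> y (i - int t) \<in> A)"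
  by (simp add: quantized_block_def atom_of_eq_iff[OF assms])

text \<open>Recurrences are searched in the strict past only. This makes the values met at recurrences
  functions of the past, hence orthogonal to the present innovation.\<close>

lemma recurrence_time_cong:
  assumes "\<And>i. i < 0 \<Longrightarrow> x i = y i"
  shows "recurrence_time B l x j = recurrence_time B l y j"
proof -
  have "quantized_block B l x t = quantized_block B l y t" for t
    using assms by (simp add: quantized_block_def)
  then show ?thesis by (induction j) simp_all
qed

section \<open>The return map preserves a stationary law\<close>

text \<open>With its defining equation as a rewrite rule, every first recurrence time would be turned into an
  infimum.\<close>

declare recurrence_time.simps(2) [simp del]

locale quantized_stationary_law = prob_space Q for Q :: "(int \<Rightarrow> real) measure" +
  fixes B :: "real set set" and l :: nat
  assumes sets_Q [measurable_cong]: "sets Q = sets paths"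
    and distr_shift: "distr Q paths (time_shift s) = Q"
    and alg: "algebra UNIV B" and fin: "finite B" and borel: "B \<subseteq> sets borel"
begin

lemma space_Q [simp]: "space Q = UNIV"
  using sets_eq_imp_space_eq[OF sets_Q] by (simp add: space_PiM)

abbreviation label :: "(int \<Rightarrow> real) \<Rightarrow> real set list" where
  "label x \<equiv> quantized_block B l x 0"

abbreviation \<tau> :: "(int \<Rightarrow> real) \<Rightarrow> nat \<Rightarrow> nat" where
  "\<tau> x j \<equiv> recurrence_time B l x j"

lemma block_label: "t > 0 \<Longrightarrow> quantized_block B l x t = label (time_shift (int t) x)"
  by (simp add: quantized_block_shift)

lemma pred_block_eq [measurable]:
  "Measurable.pred paths (\<lambda>x. quantized_block B l x s = quantized_block B l x t)"
proof -
  have [measurable]: "A \<in> sets borel" if "A \<in> B" for A using that borel by auto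
  have "Measurable.pred paths (\<lambda>x. \<forall>A\<in>B. x i \<in> A \<longleftrightarrow> x j \<in> A)" for i j
    using fin by (intro pred_intros_finite) measurable
  then show ?thesis
    unfolding quantized_block_eq_iff[OF alg fin] by measurable
qed

lemma finite_range_label: "finite (range label)"
proof (rule finite_subset)
  show "range label \<subseteq> {L. set L \<subseteq> B \<and> length L = l}"
    using atom_of_eq_Inter(2)[OF alg fin] by (auto simp: quantized_block_def is_atom_def)
qed (use fin finite_lists_length_eq in auto)

lemma pred_label_eq [measurable]: "Measurable.pred paths (\<lambda>x. label x = c)"
proof (cases "c \<in> range label")
  case True
  then obtain y where c: "c = label y" by auto
  have [measurable]: "A \<in> sets borel" if "A \<in> B" for A using that borel by auto
  have "Measurable.pred paths (\<lambda>x. \<forall>A\<in>B. x i \<in> A \<longleftrightarrow> y j \<in> A)" for i j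
    using fin by (intro pred_intros_finite) measurable
  then show ?thesis
    unfolding c quantized_block_eq_iff[OF alg fin] by measurable
next
  case False
  then have "label x \<noteq> c" for x by auto
  then show ?thesis by simp
qed

lemma measurable_recurrence_time [measurable]: "(\<lambda>x. \<tau> x j) \<in> paths \<rightarrow>\<^sub>M count_space UNIV"
proof (induction j)
  case (Suc j)
  note [measurable] = Suc
  have "(\<lambda>x. \<tau> x (Suc j)) =
      (\<lambda>x. LEAST t. \<tau> x j < t \<and> quantized_block B l x t = label x)"
    by (simp add: Inf_nat_def recurrence_time.simps(2))
  then show ?case by simp
qed simp

lemma emeasure_shift:
  assumes [measurable]: "A \<in> sets paths"
  shows "emeasure Q (time_shift s -` A) = emeasure Q A"
proof -
  have "emeasure Q A = emeasure (distr Q paths (time_shift s)) A" by (simp add: distr_shift)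
  also have "\<dots> = emeasure Q (time_shift s -` A)" by (subst emeasure_distr) auto
  finally show ?thesis by simp
qed

text \<open>Poincare recurrence. The paths with label \<open>c\<close> that never see \<open>c\<close> again form a set whose
  shifts are pairwise disjoint and equally likely, hence null; and there are finitely many labels.\<close>

lemma AE_recurrent: "AE x in Q. \<exists>t>0. quantized_block B l x t = label x"
proof -
  have "AE x in Q. label x = c \<longrightarrow> (\<exists>t>0. quantized_block B l x t = label x)" for c
  proof -
    define W where "W = {x. label x = c \<and> \<not> (\<exists>t>0. quantized_block B l x t = label x)}"
    have W [measurable]: "W \<in> sets paths"
    proof -
      have "{x\<in>space paths. label x = c \<and> \<not> (\<exists>t>0. quantized_block B l x t = label x)} \<in> sets paths"
        by measurable
      then show ?thesis by (simp add: W_def space_PiM)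
    qed
    have disj: "disjoint_family (\<lambda>n. time_shift (int n) -` W)"
    proof -
      have False if "m < n" "time_shift (int m) x \<in> W" "time_shift (int n) x \<in> W" for m n x
      proof -
        have "quantized_block B l (time_shift (int m) x) (n - m) = label (time_shift (int m) x)"
          using that by (simp add: W_def quantized_block_shift)
        moreover have "n - m > 0" using that by simp
        ultimately show False using that(2) unfolding W_def by blast
      qed
      then show ?thesis
        unfolding disjoint_family_on_def by (metis (no_types) disjoint_iff linorder_neqE_nat vimage_eq)
    qed
    have [measurable]: "time_shift s -` W \<in> sets Q" for s
      using measurable_sets[OF measurable_shift W, of s] by (simp add: sets_Q space_PiM)
    have "(\<lambda>n. measure Q (time_shift (int n) -` W)) sums measure Q (\<Union>n. time_shift (int n) -` W)"
      by (rule finite_measure_UNION) (use disj in auto)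
    moreover have "measure Q (time_shift s -` W) = measure Q W" for s
      using emeasure_shift[OF W] by (simp add: measure_def)
    ultimately have "summable (\<lambda>n::nat. measure Q W)" by (simp add: sums_iff)
    then have "measure Q W = 0" using summable_LIMSEQ_zero[of "\<lambda>n. measure Q W"] by (simp add: LIMSEQ_const_iff)
    then have "AE x in Q. x \<notin> W"
      by (intro AE_not_in) (auto simp: null_sets_def emeasure_eq_measure sets_Q)
    then show ?thesis by (auto simp: W_def)
  qed
  then have "AE x in Q. \<forall>c\<in>range label. label x = c \<longrightarrow> (\<exists>t>0. quantized_block B l x t = label x)"
    by (intro AE_finite_allI[OF finite_range_label])
  then show ?thesis by auto
qed

definition return_map :: "(int \<Rightarrow> real) \<Rightarrow> int \<Rightarrow> real" where
  "return_map x = time_shift (int (\<tau> x 1)) x"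

lemma measurable_recur [measurable]: "(\<lambda>x. time_shift (int (\<tau> x j)) x) \<in> paths \<rightarrow>\<^sub>M paths"
  by (rule measurable_compose_countable[where f="\<lambda>i x. time_shift (int i) x" and g="\<lambda>x. \<tau> x j"]) auto

lemma measurable_return_map [measurable]: "return_map \<in> paths \<rightarrow>\<^sub>M paths"
  unfolding return_map_def by measurable

lemma return_time:
  assumes "\<exists>t>0. quantized_block B l x t = label x"
  shows "\<tau> x 1 > 0" "quantized_block B l x (\<tau> x 1) = label x"
    and "0 < s \<Longrightarrow> s < \<tau> x 1 \<Longrightarrow> quantized_block B l x s \<noteq> label x"
proof -
  let ?S = "{t. t > 0 \<and> quantized_block B l x t = label x}"
  have \<tau>: "\<tau> x 1 = Inf ?S" by (simp add: recurrence_time.simps(2))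
  have "Inf ?S \<in> ?S" using assms by (intro Inf_nat_def1) auto
  then show "\<tau> x 1 > 0" "quantized_block B l x (\<tau> x 1) = label x"
    unfolding \<tau> by auto
  show "quantized_block B l x s \<noteq> label x" if "0 < s" "s < \<tau> x 1"
    using that wellorder_Inf_le1[of s ?S] unfolding \<tau> by (simp add: not_less[symmetric]) blast
qed

text \<open>A path whose first return takes time \<open>t\<close> and ends in \<open>A\<close> becomes, after the shift by \<open>t\<close>,
  a member of \<open>A\<close> whose label next occurs exactly \<open>t\<close> steps ahead. These members of \<open>A\<close> form the
  set \<open>U t\<close> below, and the next occurrence being unique, the sets \<open>U t\<close> are disjoint.\<close>

lemma emeasure_return_map_le:
  assumes A [measurable]: "A \<in> sets paths"
  shows "emeasure Q (return_map -` A) \<le> emeasure Q A"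
proof -
  define first where "first t x \<longleftrightarrow> 0 < t \<and> quantized_block B l x t = label x \<and>
      (\<forall>s\<in>{0<..<t}. quantized_block B l x s \<noteq> label x)" for t x
  have first_pred [measurable]: "Measurable.pred paths (first t)" for t
    unfolding first_def by measurable
  define U where "U t = {y \<in> A. first t (time_shift (- int t) y)}" for t
  have U [measurable]: "U t \<in> sets paths" for t
  proof -
    have "{y\<in>space paths. y \<in> A \<and> first t (time_shift (- int t) y)} \<in> sets paths"
      by measurable
    then show ?thesis by (simp add: U_def space_PiM)
  qed
  have sU [measurable]: "time_shift s -` U t \<in> sets Q" for s t
    using measurable_sets[OF measurable_shift U, of s t] by (simp add: sets_Q space_PiM)
  have disj: "disjoint_family U"
  proof -
    have False if "m < n" "y \<in> U m" "y \<in> U n" for m n y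
    proof -
      have *: "label (time_shift (- int n) y) = label y" "label (time_shift (- int m) y) = label y"
        using that by (auto simp: U_def first_def block_label)
      have "label (time_shift (- int m) y) \<noteq> label (time_shift (- int n) y)"
      proof -
        have "n - m \<in> {0<..<n}" using that by (auto simp: U_def first_def)
        then have "quantized_block B l (time_shift (- int n) y) (n - m) \<noteq> label (time_shift (- int n) y)"
          using that unfolding U_def first_def by blast
        then show ?thesis using that(1) by (simp add: block_label)
      qed
      with * show False by simp
    qed
    then show ?thesis
      unfolding disjoint_family_on_def by (metis (no_types) disjoint_iff linorder_neqE_nat)
  qed
  have "emeasure Q (return_map -` A) \<le> emeasure Q (\<Union>t. time_shift (int t) -` U t)"
  proof (rule emeasure_mono_AE)
    show "AE x in Q. x \<in> return_map -` A \<longrightarrow> x \<in> (\<Union>t. time_shift (int t) -` U t)"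
      using AE_recurrent
    proof eventually_elim
      case (elim x)
      then have "first (\<tau> x 1) x" using return_time[OF elim] by (auto simp: first_def)
      then show ?case by (auto simp: return_map_def U_def)
    qed
  qed simp
  also have "\<dots> \<le> (\<Sum>t. emeasure Q (time_shift (int t) -` U t))"
    by (intro emeasure_subadditive_countably) auto
  also have "\<dots> = (\<Sum>t. emeasure Q (U t))" by (simp add: emeasure_shift)
  also have "\<dots> = emeasure Q (\<Union>t. U t)"
    by (rule suminf_emeasure) (use disj in \<open>auto simp: sets_Q\<close>)
  also have "\<dots> \<le> emeasure Q A"
    by (rule emeasure_mono) (auto simp: U_def sets_Q)
  finally show ?thesis .
qed

text \<open>An inequality between two laws of equal total mass is an equality: apply it to the complement
  as well.\<close>

lemma distr_return_map: "distr Q paths return_map = Q"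
proof (rule measure_eqI)
  fix A assume "A \<in> sets (distr Q paths return_map)"
  then have A [measurable]: "A \<in> sets paths" by simp
  have vim: "return_map -` C \<in> sets Q" if "C \<in> sets paths" for C
    using measurable_sets[OF measurable_return_map that] by (simp add: sets_Q space_PiM)
  have le: "prob (return_map -` C) \<le> prob C" if "C \<in> sets paths" for C
    using emeasure_return_map_le[OF that] by (simp add: emeasure_eq_measure)
  have UA: "UNIV - A \<in> sets paths" using sets.compl_sets[OF A] by (simp add: space_PiM)
  have "prob (UNIV - A) = 1 - prob A" using prob_compl[of A] by (simp add: sets_Q)
  moreover have "prob (return_map -` (UNIV - A)) = 1 - prob (return_map -` A)"
    using prob_compl[OF vim[OF A]] by (simp add: vimage_Diff)
  ultimately have "prob (return_map -` A) = prob A" using le[OF A] le[OF UA] by simp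
  then show "emeasure (distr Q paths return_map) A = emeasure Q A"
    by (subst emeasure_distr) (auto simp: emeasure_eq_measure)
qed (simp add: sets_Q)

lemma measurable_return_map_pow [measurable]: "return_map ^^ j \<in> paths \<rightarrow>\<^sub>M paths"
  by (induction j) (auto simp: id_def)

lemma distr_return_map_pow: "distr Q paths (return_map ^^ j) = Q"
proof (induction j)
  case 0
  show ?case using distr_id2[OF sets_Q[symmetric]] by (simp add: id_def)
next
  case (Suc j)
  have "distr Q paths (return_map ^^ Suc j) = distr (distr Q paths (return_map ^^ j)) paths return_map"
    by (subst distr_distr) (auto simp: comp_def)
  also have "\<dots> = Q" by (simp add: Suc distr_return_map)
  finally show ?case .
qed

lemma integral_return_map_pow:
  fixes f :: "(int \<Rightarrow> real) \<Rightarrow> real"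
  assumes [measurable]: "f \<in> borel_measurable paths"
  shows "(\<integral>x. f ((return_map ^^ j) x) \<partial>Q) = (\<integral>x. f x \<partial>Q)"
  by (subst (2) distr_return_map_pow[of j, symmetric], subst integral_distr) auto

lemma AE_return_map_pow: 
  assumes "Measurable.pred paths P" "AE x in Q. P x"
  shows "AE x in Q. P ((return_map ^^ j) x)"
proof -
  have "AE x in distr Q paths (return_map ^^ j). P x" using assms unfolding distr_return_map_pow by simp
  then show ?thesis using assms by (subst (asm) AE_distr_iff) auto
qed

text \<open>The label is unchanged by the return map, so the next recurrence of the original block is the first
  recurrence seen from the current one. Invariance of the law carries almost sure recurrence along all iterates.\<close>

lemma AE_recur:
  "AE x in Q. \<forall>j. time_shift (int (\<tau> x j)) x = (return_map ^^ j) x \<and>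
     label ((return_map ^^ j) x) = label x \<and> (j > 0 \<longrightarrow> \<tau> x j > 0)"
proof -
  have "AE x in Q. \<forall>j. \<exists>t>0. quantized_block B l ((return_map ^^ j) x) t = label ((return_map ^^ j) x)"
    unfolding AE_all_countable by (intro allI AE_return_map_pow AE_recurrent) measurable
  then show ?thesis
  proof eventually_elim
    case (elim x)
    have "time_shift (int (\<tau> x j)) x = (return_map ^^ j) x \<and>
     label ((return_map ^^ j) x) = label x \<and> (j > 0 \<longrightarrow> \<tau> x j > 0)" for j
    proof (induction j)
      case (Suc j)
      define y where "y = (return_map ^^ j) x"
      have y: "y = time_shift (int (\<tau> x j)) x" and ly: "label y = label x" using Suc by (auto simp: y_def)
      have rec: "\<exists>t>0. quantized_block B l y t = label y" using elim by (simp add: y_def)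
      note ret = return_time[OF rec]
      have blk: "quantized_block B l y t = quantized_block B l x (t + \<tau> x j)" for t
        by (simp add: y quantized_block_shift)
      have "\<tau> x (Suc j) = \<tau> y 1 + \<tau> x j"
        unfolding recurrence_time.simps(2)[of B l x]
      proof (rule cInf_eq_minimum)
        show "\<tau> y 1 + \<tau> x j \<in> {t. \<tau> x j < t \<and> quantized_block B l x t = label x}"
          using ret ly by (simp add: blk)
        fix t assume t: "t \<in> {t. \<tau> x j < t \<and> quantized_block B l x t = label x}"
        then have "quantized_block B l y (t - \<tau> x j) = label y" by (simp add: blk[of "t - _"] ly)
        then show "\<tau> y 1 + \<tau> x j \<le> t" using ret(3)[of "t - \<tau> x j"] t by force
      qed
      then have "time_shift (int (\<tau> x (Suc j))) x = return_map y"
        by (simp add: return_map_def[of y]) (simp add: y)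
      moreover have "label (return_map y) = label y"
        using ret by (simp add: return_map_def quantized_block_shift)
      moreover have "(return_map ^^ Suc j) x = return_map y" by (simp add: y_def)
      ultimately show ?case
        using ret(1) ly \<open>\<tau> x (Suc j) = _\<close> by simp
    qed simp
    then show ?case by blast
  qed
qed

end

section \<open>Averages along recurrences\<close>

abbreviation past_of :: "(int \<Rightarrow> real) \<Rightarrow> int \<Rightarrow> real" where
  "past_of x \<equiv> restrict x {..<0}"

lemma measurable_past_of [measurable]: "past_of \<in> paths \<rightarrow>\<^sub>M past_algebra"
  by (rule measurable_restrict_subset) auto

lemma quantized_block_past_of [simp]: "quantized_block B l (past_of x) t = quantized_block B l x t"
  by (simp add: quantized_block_def)

context quantized_stationary_law
begin

text \<open>Here \<open>F\<close> stands for the conditional mean of \<open>h\<close> given the past, characterized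
  by the orthogonality of the innovation \<open>h (x 0) - F (past_of x)\<close> to bounded functions of the past.\<close>

context
  fixes h :: "real \<Rightarrow> real" and F :: "(int \<Rightarrow> real) \<Rightarrow> real" and H :: real
  assumes h [measurable]: "h \<in> borel_measurable borel" and h_le: "\<And>u. \<bar>h u\<bar> \<le> H"
    and F [measurable]: "F \<in> borel_measurable past_algebra"
    and F_le: "\<And>y. y \<in> space past_algebra \<Longrightarrow> \<bar>F y\<bar> \<le> H"
    and orth: "\<And>G C. G \<in> borel_measurable past_algebra \<Longrightarrow> (\<And>y. y \<in> space past_algebra \<Longrightarrow> \<bar>G y\<bar> \<le> C) \<Longrightarrow>
      (\<integral>x. (h (x 0) - F (past_of x)) * G (past_of x) \<partial>Q) = 0"
begin

definition innov :: "(int \<Rightarrow> real) \<Rightarrow> real" where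
  "innov x = h (x 0) - F (past_of x)"

lemma measurable_innov [measurable]: "innov \<in> borel_measurable paths"
  unfolding innov_def by measurable

lemma past_of_space: "past_of x \<in> space past_algebra"
  by (simp add: space_PiM)

lemma abs_innov_le: "\<bar>innov x\<bar> \<le> 2 * H"
  using h_le[of "x 0"] F_le[OF past_of_space, of x] by (simp add: innov_def)

text \<open>At a recurrence one looks at least one step back, so the innovation there is a function of the
  past of the origin.\<close>

lemma integral_innov_return_eq_0:
  assumes "m > 0"
  shows "(\<integral>x. innov x * innov ((return_map ^^ m) x) \<partial>Q) = 0"
proof -
  \<comment> \<open>Filling in zeros at the times that are forgotten turns a past into a path, on which recurrence
    times can be evaluated.\<close>
  define ext :: "(int \<Rightarrow> real) \<Rightarrow> int \<Rightarrow> real" where "ext y = (\<lambda>i. if i < 0 then y i else 0)" for y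
  have ext [measurable]: "ext \<in> past_algebra \<rightarrow>\<^sub>M paths"
  proof (rule measurable_PiM_single')
    fix i :: int
    show "(\<lambda>y. ext y i) \<in> borel_measurable past_algebra"
      by (cases "i < 0") (simp_all add: ext_def)
  qed (simp add: space_PiM)
  define G where "G y = innov (time_shift (int (\<tau> (ext y) m)) (ext y))" for y
  have [measurable]: "G \<in> borel_measurable past_algebra"
    unfolding G_def by measurable
  have G: "innov ((return_map ^^ m) x) = G (past_of x)"
    if *: "time_shift (int (\<tau> x m)) x = (return_map ^^ m) x" "\<tau> x m > 0" for x
  proof -
    have "\<tau> (ext (past_of x)) m = \<tau> x m"
      by (rule recurrence_time_cong) (simp add: ext_def)
    then show ?thesis
      using * by (simp add: G_def innov_def time_shift_def ext_def flip: *(1) cong: restrict_cong)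
  qed
  have "(\<integral>x. innov x * innov ((return_map ^^ m) x) \<partial>Q) = (\<integral>x. innov x * G (past_of x) \<partial>Q)"
    by (rule integral_cong_AE) (use AE_recur assms in \<open>auto elim!: eventually_mono simp: G\<close>)
  also have "\<dots> = 0"
    unfolding innov_def by (rule orth[of G "2 * H"]) (auto simp: G_def abs_innov_le)
  finally show ?thesis .
qed

lemma integrable_innov_prod: "integrable Q (\<lambda>x. innov ((return_map ^^ i) x) * innov ((return_map ^^ j) x))"
proof (rule integrable_const_bound[where B = "(2 * H) * (2 * H)"])
  show "AE x in Q. norm (innov ((return_map ^^ i) x) * innov ((return_map ^^ j) x)) \<le> 2 * H * (2 * H)"
    unfolding real_norm_def abs_mult using abs_innov_le order_trans[OF abs_ge_zero abs_innov_le]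
    by (intro AE_I2 mult_mono) auto
qed measurable

text \<open>Invariance of the law under the return map moves the earlier of two recurrences to the origin.\<close>

lemma integral_innov_returns_eq_0:
  assumes "i \<noteq> j"
  shows "(\<integral>x. innov ((return_map ^^ i) x) * innov ((return_map ^^ j) x) \<partial>Q) = 0"
proof -
  have *: "(\<integral>x. innov ((return_map ^^ i) x) * innov ((return_map ^^ j) x) \<partial>Q) = 0" if "i < j" for i j
  proof -
    have "(return_map ^^ j) x = (return_map ^^ (j - i)) ((return_map ^^ i) x)" for x
      using that by (simp flip: funpow_add[THEN fun_cong, unfolded comp_def])
    then show ?thesis
      using integral_return_map_pow[of "\<lambda>x. innov x * innov ((return_map ^^ (j - i)) x)" i]
        integral_innov_return_eq_0[of "j - i"] that by simp
  qed
  show ?thesis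
    using *[of i j] *[of j i] assms by (cases i j rule: linorder_cases) (auto simp: mult.commute)
qed

text \<open>The law of large numbers for orthogonal bounded variables: the mean square of their average is of
  order \<open>1 / n\<close>.\<close>

lemma integral_abs_mean_innov_le:
  assumes "n > 0"
  shows "(\<integral>x. \<bar>1 / real n * (\<Sum>j=1..n. innov ((return_map ^^ j) x))\<bar> \<partial>Q) \<le> 2 * H / sqrt n"
proof -
  define S where "S x = \<bar>1 / real n * (\<Sum>j=1..n. innov ((return_map ^^ j) x))\<bar>" for x
  have [measurable]: "S \<in> borel_measurable paths" unfolding S_def by measurable
  have S_sq: "(S x)\<^sup>2 = 1 / (real n)\<^sup>2 *
      (\<Sum>i=1..n. \<Sum>j=1..n. innov ((return_map ^^ i) x) * innov ((return_map ^^ j) x))" for x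
    by (simp add: S_def power_mult_distrib power_divide power2_eq_square sum_product)
  have int_sq: "integrable Q (\<lambda>x. (S x)\<^sup>2)"
    unfolding S_sq by (intro integrable_mult_right Bochner_Integration.integrable_sum integrable_innov_prod)
  have int: "integrable Q S"
    by (rule square_integrable_imp_integrable[OF _ int_sq]) measurable
  have "(expectation S)\<^sup>2 \<le> expectation (\<lambda>x. (S x)\<^sup>2)"
    using variance_positive[of S] variance_eq[OF int int_sq] by simp
  also have "\<dots> = 1 / (real n)\<^sup>2 * (\<Sum>i=1..n. \<Sum>j=1..n.
      \<integral>x. innov ((return_map ^^ i) x) * innov ((return_map ^^ j) x) \<partial>Q)"
    unfolding S_sq by (simp add: integrable_innov_prod Bochner_Integration.integral_sum)
  also have "\<dots> = 1 / (real n)\<^sup>2 * (\<Sum>i=1..n. \<integral>x. innov ((return_map ^^ i) x) * innov ((return_map ^^ i) x) \<partial>Q)"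
  proof (intro arg_cong2[where f = "(*)"] refl sum.cong)
    fix i assume "i \<in> {1..n}"
    show "(\<Sum>j=1..n. \<integral>x. innov ((return_map ^^ i) x) * innov ((return_map ^^ j) x) \<partial>Q) =
        (\<integral>x. innov ((return_map ^^ i) x) * innov ((return_map ^^ i) x) \<partial>Q)"
      using \<open>i \<in> {1..n}\<close>
      by (subst sum.remove[of _ i]) (auto intro!: sum.neutral integral_innov_returns_eq_0)
  qed
  also have "\<dots> \<le> 1 / (real n)\<^sup>2 * (\<Sum>i=1..n. (2 * H)\<^sup>2)"
  proof (intro mult_left_mono sum_mono)
    fix i
    have "(\<integral>x. innov ((return_map ^^ i) x) * innov ((return_map ^^ i) x) \<partial>Q) \<le> (\<integral>x. (2 * H)\<^sup>2 \<partial>Q)"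
    proof (rule integral_mono[OF integrable_innov_prod])
      show "innov ((return_map ^^ i) x) * innov ((return_map ^^ i) x) \<le> (2 * H)\<^sup>2" for x
        using abs_innov_le power_mono[of "\<bar>innov ((return_map ^^ i) x)\<bar>" "2 * H" 2]
        by (simp add: power2_eq_square)
    qed simp
    then show "(\<integral>x. innov ((return_map ^^ i) x) * innov ((return_map ^^ i) x) \<partial>Q) \<le> (2 * H)\<^sup>2"
      using prob_space by simp
  qed simp
  also have "\<dots> = (2 * H / sqrt n)\<^sup>2"
    using assms by (simp add: power_divide power2_eq_square field_simps)
  finally have "(expectation S)\<^sup>2 \<le> (2 * H / sqrt n)\<^sup>2" .
  moreover have "0 \<le> 2 * H / sqrt n"
    using h_le[of 0] by simp
  ultimately show ?thesis
    unfolding S_def by (rule power2_le_imp_le)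
qed

text \<open>A function \<open>g\<close> of the label takes the same value at all recurrences as at the origin, so only
  \<open>F - g\<close> contributes; by invariance it contributes equally at every recurrence, whatever \<open>n\<close> is.\<close>

lemma integral_bias_le:
  assumes g [measurable]: "g \<in> borel_measurable past_algebra"
    and int_g: "integrable Q (\<lambda>x. g (past_of x))"
    and label_g: "\<And>y z. label y = label z \<Longrightarrow> g (past_of y) = g (past_of z)"
    and "n > 0"
  shows "(\<integral>x. \<bar>1 / real n * (\<Sum>j=1..n. F (past_of ((return_map ^^ j) x))) - F (past_of x)\<bar> \<partial>Q)
    \<le> 2 * (\<integral>x. \<bar>F (past_of x) - g (past_of x)\<bar> \<partial>Q)"
proof -
  define e where "e x = \<bar>F (past_of x) - g (past_of x)\<bar>" for x
  have [measurable]: "e \<in> borel_measurable paths" unfolding e_def by measurable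
  have int_F: "integrable Q (\<lambda>x. F (past_of x))"
    by (rule integrable_const_bound[where B = H]) (auto simp: F_le past_of_space)
  have int_e: "integrable Q e"
    unfolding e_def by (intro integrable_abs Bochner_Integration.integrable_diff int_F int_g)
  have int_ej: "integrable Q (\<lambda>x. e ((return_map ^^ j) x))" for j
    using int_e integrable_distr[of "return_map ^^ j" Q paths e] by (simp add: distr_return_map_pow)
  have int_Fj: "integrable Q (\<lambda>x. F (past_of ((return_map ^^ j) x)))" for j
    by (rule integrable_const_bound[where B = H]) (auto simp: F_le past_of_space)
  have "(\<integral>x. \<bar>1 / real n * (\<Sum>j=1..n. F (past_of ((return_map ^^ j) x))) - F (past_of x)\<bar> \<partial>Q)
      \<le> (\<integral>x. 1 / real n * (\<Sum>j=1..n. e ((return_map ^^ j) x)) + e x \<partial>Q)"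
  proof (rule integral_mono_AE)
    show "AE x in Q. \<bar>1 / real n * (\<Sum>j=1..n. F (past_of ((return_map ^^ j) x))) - F (past_of x)\<bar>
        \<le> 1 / real n * (\<Sum>j=1..n. e ((return_map ^^ j) x)) + e x"
      using AE_recur
    proof eventually_elim
      case (elim x)
      have g_eq: "g (past_of ((return_map ^^ j) x)) = g (past_of x)" for j
        by (rule label_g) (use elim in blast)
      have "\<bar>1 / real n * (\<Sum>j=1..n. F (past_of ((return_map ^^ j) x))) - F (past_of x)\<bar> =
         \<bar>1 / real n * (\<Sum>j=1..n. F (past_of ((return_map ^^ j) x)) - g (past_of ((return_map ^^ j) x)))
          - (F (past_of x) - g (past_of x))\<bar>"
        using \<open>n > 0\<close> by (simp add: g_eq sum_subtractf field_simps)
      also have "\<dots> \<le> 1 / real n * \<bar>\<Sum>j=1..n. F (past_of ((return_map ^^ j) x)) - g (past_of ((return_map ^^ j) x))\<bar> + e x"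
        unfolding e_def by (rule order_trans[OF abs_triangle_ineq4]) (simp add: abs_mult)
      also have "\<dots> \<le> 1 / real n * (\<Sum>j=1..n. e ((return_map ^^ j) x)) + e x"
        unfolding e_def by (intro add_right_mono mult_left_mono sum_abs) simp
      finally show ?case .
    qed
    show "integrable Q (\<lambda>x. 1 / real n * (\<Sum>j=1..n. e ((return_map ^^ j) x)) + e x)"
      by (intro Bochner_Integration.integrable_add integrable_mult_right Bochner_Integration.integrable_sum
          int_e int_ej)
    show "integrable Q (\<lambda>x. \<bar>1 / real n * (\<Sum>j=1..n. F (past_of ((return_map ^^ j) x))) - F (past_of x)\<bar>)"
      by (intro integrable_abs Bochner_Integration.integrable_diff integrable_mult_right
          Bochner_Integration.integrable_sum int_F int_Fj)
  qed
  also have "\<dots> = 1 / real n * (\<Sum>j=1..n. \<integral>x. e ((return_map ^^ j) x) \<partial>Q) + (\<integral>x. e x \<partial>Q)"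
    by (simp add: int_e int_ej Bochner_Integration.integral_sum)
  also have "\<dots> = 2 * (\<integral>x. e x \<partial>Q)"
    using \<open>n > 0\<close> by (simp add: integral_return_map_pow)
  finally show ?thesis by (simp add: e_def)
qed

text \<open>The error splits into a noise term, the mean of the innovations, and a bias term, the fluctuation
  of the conditional mean over the recurrences.\<close>

lemma integral_recurrence_mean_le:
  assumes g [measurable]: "g \<in> borel_measurable past_algebra"
    and int_g: "integrable Q (\<lambda>x. g (past_of x))"
    and label_g: "\<And>y z. label y = label z \<Longrightarrow> g (past_of y) = g (past_of z)"
    and "n > 0"
  shows "(\<integral>x. \<bar>1 / real n * (\<Sum>j=1..n. h (x (- int (\<tau> x j)))) - F (past_of x)\<bar> \<partial>Q)
    \<le> 2 * H / sqrt n + 2 * (\<integral>x. \<bar>F (past_of x) - g (past_of x)\<bar> \<partial>Q)"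
proof -
  let ?N = "\<lambda>x. 1 / real n * (\<Sum>j=1..n. innov ((return_map ^^ j) x))"
  let ?D = "\<lambda>x. 1 / real n * (\<Sum>j=1..n. F (past_of ((return_map ^^ j) x))) - F (past_of x)"
  have int_F: "integrable Q (\<lambda>x. F (past_of ((return_map ^^ j) x)))" for j
    by (rule integrable_const_bound[where B = H]) (auto simp: F_le past_of_space)
  have int_innov: "integrable Q (\<lambda>x. innov ((return_map ^^ j) x))" for j
    by (rule integrable_const_bound[where B = "2 * H"]) (auto simp: abs_innov_le)
  have int_N: "integrable Q ?N"
    by (intro integrable_mult_right Bochner_Integration.integrable_sum int_innov)
  have int_D: "integrable Q ?D"
    using int_F[of 0] by (intro Bochner_Integration.integrable_diff integrable_mult_right
        Bochner_Integration.integrable_sum int_F) simp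
  have eq: "AE x in Q. 1 / real n * (\<Sum>j=1..n. h (x (- int (\<tau> x j)))) - F (past_of x) = ?N x + ?D x"
    using AE_recur
  proof eventually_elim
    case (elim x)
    have "h (x (- int (\<tau> x j))) = h ((return_map ^^ j) x 0)" for j
      using elim[THEN spec, of j, THEN conjunct1, THEN fun_cong, of 0] by (simp add: time_shift_def)
    then show ?case by (simp add: innov_def sum_subtractf algebra_simps)
  qed
  have [measurable]: "(\<lambda>x. x (- int (\<tau> x j))) \<in> borel_measurable paths" for j
    using measurable_compose[OF measurable_recur measurable_component_singleton[of 0], of j]
    by (simp add: time_shift_def)
  have "(\<integral>x. \<bar>1 / real n * (\<Sum>j=1..n. h (x (- int (\<tau> x j)))) - F (past_of x)\<bar> \<partial>Q)
      = (\<integral>x. \<bar>?N x + ?D x\<bar> \<partial>Q)"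
    by (rule integral_cong_AE) (use eq in auto)
  also have "\<dots> \<le> (\<integral>x. \<bar>?N x\<bar> + \<bar>?D x\<bar> \<partial>Q)"
    by (intro integral_mono integrable_abs Bochner_Integration.integrable_add int_N int_D abs_triangle_ineq)
  also have "\<dots> = (\<integral>x. \<bar>?N x\<bar> \<partial>Q) + (\<integral>x. \<bar>?D x\<bar> \<partial>Q)"
    by (intro Bochner_Integration.integral_add integrable_abs int_N int_D)
  also have "\<dots> \<le> 2 * H / sqrt n + 2 * (\<integral>x. \<bar>F (past_of x) - g (past_of x)\<bar> \<partial>Q)"
    using integral_abs_mean_innov_le[OF \<open>n > 0\<close>] integral_bias_le[OF assms] by linarith
  finally show ?thesis .
qed

end
end

section \<open>Functions of the past as limits of functions of a block\<close>

lemma quantized_block_refine: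
  assumes "algebra UNIV B" "finite B" "algebra UNIV B'" "finite B'" "B \<subseteq> B'" "l \<le> l'"
    and "quantized_block B' l' x s = quantized_block B' l' y t"
  shows "quantized_block B l x s = quantized_block B l y t"
  using assms(5-7) unfolding quantized_block_eq_iff[OF assms(1,2)] quantized_block_eq_iff[OF assms(3,4)]
  by force

locale refining_quantizers =
  fixes B :: "nat \<Rightarrow> real set set" and l :: "nat \<Rightarrow> nat"
  assumes alg: "\<And>k. k \<ge> 1 \<Longrightarrow> algebra UNIV (B k)" and fin: "\<And>k. k \<ge> 1 \<Longrightarrow> finite (B k)"
    and sub_Suc: "\<And>k. k \<ge> 1 \<Longrightarrow> B k \<subseteq> B (Suc k)"
    and borel: "sigma_sets UNIV (\<Union>k\<in>{1..}. B k) = sets borel"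
    and l_mono: "mono_on {1..} l" and l_unbdd: "\<not> bdd_above (l ` {1..})"
begin

lemma B_mono: "1 \<le> k \<Longrightarrow> k \<le> k' \<Longrightarrow> B k \<subseteq> B k'"
proof (induction k')
  case (Suc n)
  then show ?case using sub_Suc[of n] by (cases "k = Suc n") auto
qed simp

lemma block_refine:
  assumes "1 \<le> k" "k \<le> k'" "quantized_block (B k') (l k') x s = quantized_block (B k') (l k') y t"
  shows "quantized_block (B k) (l k) x s = quantized_block (B k) (l k) y t"
proof (rule quantized_block_refine[OF _ _ _ _ _ _ assms(3)])
  show "l k \<le> l k'" using assms by (intro mono_onD[OF l_mono]) auto
qed (use assms alg fin B_mono in auto)

definition block_function :: "nat \<Rightarrow> ((int \<Rightarrow> real) \<Rightarrow> real) \<Rightarrow> bool" where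
  "block_function k g \<longleftrightarrow> g \<in> borel_measurable past_algebra \<and>
     (\<forall>y\<in>space past_algebra. \<forall>z\<in>space past_algebra.
        quantized_block (B k) (l k) y 0 = quantized_block (B k) (l k) z 0 \<longrightarrow> g y = g z)"

lemma block_function_mono: "block_function k g \<Longrightarrow> 1 \<le> k \<Longrightarrow> k \<le> k' \<Longrightarrow> block_function k' g"
  unfolding block_function_def using block_refine by blast

text \<open>The level \<open>k\<close> of the approximant is free: a function of the block at level \<open>k\<close> is one at all
  later levels too. Density of these functions in \<open>L\<^sup>1\<close> does the work of martingale convergence
  of the conditional expectations given the blocks.\<close>

definition block_approximable :: "(int \<Rightarrow> real) measure \<Rightarrow> ((int \<Rightarrow> real) \<Rightarrow> real) \<Rightarrow> bool" where
  "block_approximable N f \<longleftrightarrow> integrable N f \<and>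
    (\<forall>e>0. \<exists>k\<ge>1. \<exists>g. block_function k g \<and> integrable N g \<and> (\<integral>y. \<bar>f y - g y\<bar> \<partial>N) < e)"

lemma block_approximable_const: 
  assumes "finite_measure N"
  shows "block_approximable N (\<lambda>y. c)"
proof -
  interpret finite_measure N by fact
  show ?thesis
    unfolding block_approximable_def block_function_def by (auto intro!: exI[of _ 1] exI[of _ "\<lambda>y. c"])
qed

lemma block_approximable_cong:
  assumes "\<And>y. y \<in> space N \<Longrightarrow> f y = f' y"
  shows "block_approximable N f \<longleftrightarrow> block_approximable N f'"
proof -
  have "(\<integral>y. \<bar>f y - g y\<bar> \<partial>N) = (\<integral>y. \<bar>f' y - g y\<bar> \<partial>N)" for g
    by (rule Bochner_Integration.integral_cong) (simp_all add: assms)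
  moreover have "integrable N f \<longleftrightarrow> integrable N f'"
    by (rule Bochner_Integration.integrable_cong) (simp_all add: assms)
  ultimately show ?thesis by (simp add: block_approximable_def)
qed

text \<open>Approximants of two functions, brought to a common level, can be combined by any Lipschitz
  operation. Sums, differences, maxima and multiples are instances.\<close>

lemma block_approximable_combine:
  assumes f1: "block_approximable N f1" and f2: "block_approximable N f2"
    and N: "sets N = sets past_algebra"
    and c: "\<And>a b a' b'. \<bar>c a b - c a' b'\<bar> \<le> L * (\<bar>a - a'\<bar> + \<bar>b - b'\<bar>)" and "L > 0"
    and c_meas [measurable]: "case_prod c \<in> borel_measurable (borel \<Otimes>\<^sub>M borel)" 
    and c_int: "\<And>u v. integrable N u \<Longrightarrow> integrable N v \<Longrightarrow> integrable N (\<lambda>y. c (u y) (v y))"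
  shows "block_approximable N (\<lambda>y. c (f1 y) (f2 y) :: real)"
  unfolding block_approximable_def
proof (intro conjI allI impI)
  note [measurable_cong] = N
  have int: "integrable N f1" "integrable N f2" using f1 f2 by (auto simp: block_approximable_def)
  show "integrable N (\<lambda>y. c (f1 y) (f2 y))" by (intro c_int int)
  fix e :: real assume "e > 0"
  then have "e / (2 * L) > 0" using \<open>L > 0\<close> by simp
  obtain k1 g1 where g1: "k1 \<ge> 1" "block_function k1 g1" "integrable N g1" "(\<integral>y. \<bar>f1 y - g1 y\<bar> \<partial>N) < e / (2 * L)"
    using f1 \<open>e / (2 * L) > 0\<close> unfolding block_approximable_def by meson
  obtain k2 g2 where g2: "k2 \<ge> 1" "block_function k2 g2" "integrable N g2" "(\<integral>y. \<bar>f2 y - g2 y\<bar> \<partial>N) < e / (2 * L)"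
    using f2 \<open>e / (2 * L) > 0\<close> unfolding block_approximable_def by meson
  define k where "k = max k1 k2"
  have bf: "block_function k g1" "block_function k g2"
    using block_function_mono[OF g1(2,1)] block_function_mono[OF g2(2,1)] by (auto simp: k_def)
  then have [measurable]: "g1 \<in> borel_measurable past_algebra" "g2 \<in> borel_measurable past_algebra"
    by (auto simp: block_function_def)
  have "block_function k (\<lambda>y. c (g1 y) (g2 y))"
    unfolding block_function_def
  proof (intro conjI ballI impI)
    have "(\<lambda>y. case_prod c (g1 y, g2 y)) \<in> borel_measurable past_algebra" by measurable
    then show "(\<lambda>y. c (g1 y) (g2 y)) \<in> borel_measurable past_algebra" by simp
    fix y z assume *: "y \<in> space past_algebra" "z \<in> space past_algebra"
      "quantized_block (B k) (l k) y 0 = quantized_block (B k) (l k) z 0"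
    then have "g1 y = g1 z" "g2 y = g2 z" using bf unfolding block_function_def by blast+
    then show "c (g1 y) (g2 y) = c (g1 z) (g2 z)" by simp
  qed
  moreover have "(\<integral>y. \<bar>c (f1 y) (f2 y) - c (g1 y) (g2 y)\<bar> \<partial>N) < e"
  proof -
    have "(\<integral>y. \<bar>c (f1 y) (f2 y) - c (g1 y) (g2 y)\<bar> \<partial>N) \<le> (\<integral>y. L * (\<bar>f1 y - g1 y\<bar> + \<bar>f2 y - g2 y\<bar>) \<partial>N)"
      by (intro integral_mono c integrable_mult_right integrable_abs Bochner_Integration.integrable_diff
          Bochner_Integration.integrable_add c_int int g1 g2)
    also have "\<dots> = L * ((\<integral>y. \<bar>f1 y - g1 y\<bar> \<partial>N) + (\<integral>y. \<bar>f2 y - g2 y\<bar> \<partial>N))"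
      using int g1 g2 by simp
    also have "\<dots> < L * (e / (2 * L) + e / (2 * L))"
      using g1 g2 \<open>L > 0\<close> by (intro mult_strict_left_mono add_strict_mono)
    also have "\<dots> = e" using \<open>L > 0\<close> by simp
    finally show ?thesis .
  qed
  ultimately show "\<exists>k\<ge>1. \<exists>g. block_function k g \<and> integrable N g \<and> (\<integral>y. \<bar>c (f1 y) (f2 y) - g y\<bar> \<partial>N) < e"
    using g1(1) c_int[OF g1(3) g2(3)] by (intro exI[of _ k] conjI exI[of _ "\<lambda>y. c (g1 y) (g2 y)"]) (auto simp: k_def)
qed

lemma block_approximable_add:
  assumes "block_approximable N f1" "block_approximable N f2" "sets N = sets past_algebra"
  shows "block_approximable N (\<lambda>y. f1 y + f2 y)"
  by (rule block_approximable_combine[where c = "\<lambda>a b. a + b" and L = 1, OF assms]) auto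

lemma block_approximable_diff:
  assumes "block_approximable N f1" "block_approximable N f2" "sets N = sets past_algebra"
  shows "block_approximable N (\<lambda>y. f1 y - f2 y)"
  by (rule block_approximable_combine[where c = "\<lambda>a b. a - b" and L = 1, OF assms]) auto

lemma block_approximable_max:
  assumes "block_approximable N f1" "block_approximable N f2" "sets N = sets past_algebra"
  shows "block_approximable N (\<lambda>y. max (f1 y) (f2 y))"
  by (rule block_approximable_combine[where c = max and L = 1, OF assms]) auto

lemma block_approximable_scale:
  assumes f: "block_approximable N f" and N: "sets N = sets past_algebra"
  shows "block_approximable N (\<lambda>y. c * f y)"
proof (rule block_approximable_combine[where c = "\<lambda>a b. c * a" and L = "\<bar>c\<bar> + 1", OF f f N])
  show "\<bar>c * a - c * a'\<bar> \<le> (\<bar>c\<bar> + 1) * (\<bar>a - a'\<bar> + \<bar>b - b'\<bar>)" for a b a' b' :: real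
    unfolding right_diff_distrib[symmetric] abs_mult by (intro mult_mono) auto
qed auto

lemma block_approximable_closed:
  assumes s: "\<And>n::nat. block_approximable N (s n)" and f: "integrable N f"
    and lim: "(\<lambda>n. \<integral>y. \<bar>f y - s n y\<bar> \<partial>N) \<longlonglongrightarrow> 0"
  shows "block_approximable N f"
  unfolding block_approximable_def
proof (intro conjI allI impI f)
  fix e :: real assume "e > 0"
  then have "eventually (\<lambda>n. (\<integral>y. \<bar>f y - s n y\<bar> \<partial>N) < e / 2) sequentially"
    using lim by (intro order_tendstoD) auto
  then obtain n where n: "(\<integral>y. \<bar>f y - s n y\<bar> \<partial>N) < e / 2"
    by (auto simp: eventually_sequentially)
  have int: "integrable N (s n)" using s by (simp add: block_approximable_def)
  obtain k g where g: "k \<ge> 1" "block_function k g" "integrable N g" "(\<integral>y. \<bar>s n y - g y\<bar> \<partial>N) < e / 2"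
    using s[of n] \<open>e > 0\<close> unfolding block_approximable_def by (meson half_gt_zero)
  have "(\<integral>y. \<bar>f y - g y\<bar> \<partial>N) \<le> (\<integral>y. \<bar>f y - s n y\<bar> + \<bar>s n y - g y\<bar> \<partial>N)"
    by (intro integral_mono integrable_abs Bochner_Integration.integrable_diff
        Bochner_Integration.integrable_add f int g) auto
  also have "\<dots> = (\<integral>y. \<bar>f y - s n y\<bar> \<partial>N) + (\<integral>y. \<bar>s n y - g y\<bar> \<partial>N)"
    by (intro Bochner_Integration.integral_add integrable_abs Bochner_Integration.integrable_diff int g f)
  finally show "\<exists>k\<ge>1. \<exists>g. block_function k g \<and> integrable N g \<and> (\<integral>y. \<bar>f y - g y\<bar> \<partial>N) < e"
    using g n by (intro exI[of _ k] conjI exI[of _ g]) auto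
qed

text \<open>At a level at which the block reaches back to time \<open>i\<close>, the block decides whether the value at
  time \<open>i\<close> lies in \<open>A\<close>, because every atom lies inside \<open>A\<close> or outside.\<close>

lemma block_approximable_cylinder:
  assumes "i < 0" "k \<ge> 1" "A \<in> B k" and N: "sets N = sets past_algebra" and "finite_measure N"
  shows "block_approximable N (indicator {y \<in> space past_algebra. y i \<in> A})"
proof -
  interpret finite_measure N by fact
  note [measurable_cong] = N
  obtain m where m: "m \<ge> 1" "nat (- i) \<le> l m"
    using l_unbdd unfolding bdd_above_def by (metis atLeast_iff imageE nat_le_linear)
  define k' where "k' = max k m"
  have k': "k' \<ge> 1" "k \<le> k'" "m \<le> k'" using m by (auto simp: k'_def)
  have lk: "- i \<le> int (l k')"
    using m mono_onD[OF l_mono, of m k'] k' by simp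
  have A: "A \<in> B k'" using B_mono[of k k'] assms(2,3) k' by auto
  have A_meas [measurable]: "A \<in> sets borel" using borel assms by auto
  let ?g = "indicator {y \<in> space past_algebra. y i \<in> A} :: _ \<Rightarrow> real"
  have mi [measurable]: "(\<lambda>y. y i) \<in> borel_measurable past_algebra"
    using assms(1) by (intro measurable_component_singleton) auto
  have [measurable]: "{y \<in> space past_algebra. y i \<in> A} \<in> sets past_algebra" by measurable
  have "block_function k' ?g"
    unfolding block_function_def
  proof (intro conjI ballI impI)
    fix y z assume *: "y \<in> space past_algebra" "z \<in> space past_algebra"
      "quantized_block (B k') (l k') y 0 = quantized_block (B k') (l k') z 0"
    then have "y i \<in> A \<longleftrightarrow> z i \<in> A"
      unfolding quantized_block_eq_iff[OF alg[OF k'(1)] fin[OF k'(1)]] using A lk assms(1) by force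
    then show "?g y = ?g z" using * by (simp add: indicator_def)
  qed measurable
  moreover have "integrable N ?g"
    by (rule integrable_const_bound[where B = 1]) auto
  ultimately show ?thesis
    unfolding block_approximable_def using k'(1) by (auto intro!: exI[of _ k'] exI[of _ ?g])
qed

text \<open>The events with approximable indicator form a \<open>\<sigma>\<close>-algebra. It is generated from the cylinders in
  two stages: first over the base of one coordinate, where the quantizers generate the Borel sets,
  then over the coordinates.\<close>

lemma block_approximable_set:
  assumes N: "sets N = sets past_algebra" and fin: "finite_measure N" and A: "A \<in> sets past_algebra"
  shows "block_approximable N (indicator A)"
proof -
  interpret finite_measure N by fact
  note [measurable_cong] = N
  have sp: "space N = space past_algebra" using N by (rule sets_eq_imp_space_eq)
  define \<A> where "\<A> = {A \<in> sets past_algebra. block_approximable N (indicator A)}"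
  have compl: "space past_algebra - A \<in> \<A>" if "A \<in> \<A>" for A
  proof -
    have [measurable]: "A \<in> sets past_algebra" using that by (simp add: \<A>_def)
    have "block_approximable N (\<lambda>y. 1 - indicator A y)"
      using that by (intro block_approximable_diff block_approximable_const N fin) (simp add: \<A>_def)
    then have "block_approximable N (indicator (space past_algebra - A))"
      by (subst block_approximable_cong[where f' = "\<lambda>y. 1 - indicator A y"])
        (auto simp: sp indicator_def)
    then show ?thesis by (simp add: \<A>_def)
  qed
  have un2: "A \<union> A' \<in> \<A>" if "A \<in> \<A>" "A' \<in> \<A>" for A A'
  proof -
    have "block_approximable N (\<lambda>y. max (indicator A y) (indicator A' y))"
      using that by (intro block_approximable_max N) (auto simp: \<A>_def)
    moreover have "(\<lambda>y. max (indicator A y) (indicator A' y) :: real) = indicator (A \<union> A')"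
      by (auto simp: indicator_def fun_eq_iff)
    ultimately show ?thesis using that by (auto simp: \<A>_def)
  qed
  have empty: "{} \<in> \<A>"
    using block_approximable_const[OF fin, of 0] by (simp add: \<A>_def indicator_def[abs_def])
  have un: "(\<Union>n::nat. A n) \<in> \<A>" if A: "\<And>n. A n \<in> \<A>" for A
  proof -
    define U where "U n = (\<Union>i<n. A i)" for n
    have U: "U n \<in> \<A>" for n
      by (induction n) (auto simp: U_def lessThan_Suc empty intro!: un2 A)
    have [measurable]: "A n \<in> sets past_algebra" "U n \<in> sets past_algebra" for n
      using A U by (auto simp: \<A>_def)
    have "block_approximable N (indicator (\<Union>n. A n))"
    proof (rule block_approximable_closed)
      show "block_approximable N (indicator (U n))" for n using U by (simp add: \<A>_def)
      show "integrable N (indicator (\<Union>n. A n) :: _ \<Rightarrow> real)"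
        by (rule integrable_const_bound[where B = 1]) auto
      have "(\<lambda>n. \<integral>y. \<bar>indicator (\<Union>n. A n) y - indicator (U n) y :: real\<bar> \<partial>N) \<longlonglongrightarrow> (\<integral>y. (0::real) \<partial>N)"
      proof (rule integral_dominated_convergence[where w = "\<lambda>_. 1"])
        show "AE y in N. (\<lambda>n. \<bar>indicator (\<Union>n. A n) y - indicator (U n) y\<bar> :: real) \<longlonglongrightarrow> 0"
        proof (intro AE_I2 tendsto_eventually)
          fix y
          show "eventually (\<lambda>n. \<bar>indicator (\<Union>n. A n) y - indicator (U n) y\<bar> = (0::real)) sequentially"
          proof (cases "y \<in> (\<Union>n. A n)")
            case True
            then obtain m where "y \<in> A m" by auto
            then show ?thesis
              by (intro eventually_mono[OF eventually_gt_at_top[of m]]) (auto simp: U_def indicator_def)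
          next
            case False
            then show ?thesis by (auto simp: U_def indicator_def)
          qed
        qed
      qed (auto simp: indicator_def)
      then show "(\<lambda>n. \<integral>y. \<bar>indicator (\<Union>n. A n) y - indicator (U n) y :: real\<bar> \<partial>N) \<longlonglongrightarrow> 0" by simp
    qed
    then show ?thesis by (simp add: \<A>_def)
  qed
  have cyl: "{y \<in> space past_algebra. y i \<in> C} \<in> \<A>" if "i < 0" "C \<in> sets borel" for i C
  proof -
    have mi [measurable]: "(\<lambda>y. y i) \<in> borel_measurable past_algebra"
      using that(1) by (intro measurable_component_singleton) auto
    have "C \<in> sigma_sets UNIV (\<Union>k\<in>{1..}. B k)" using that borel by simp
    then show ?thesis
    proof induction
      case (Basic C)
      then obtain k where k: "k \<ge> 1" "C \<in> B k" by auto
      then have [measurable]: "C \<in> sets borel" using borel by auto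
      show ?case
        using block_approximable_cylinder[OF that(1) k N fin] by (simp add: \<A>_def)
    next
      case Empty
      show ?case using empty by simp
    next
      case (Compl C)
      have "{y \<in> space past_algebra. y i \<in> UNIV - C} = space past_algebra - {y \<in> space past_algebra. y i \<in> C}"
        by auto
      then show ?case using compl[OF Compl.IH] by simp
    next
      case (Union C)
      have "{y \<in> space past_algebra. y i \<in> \<Union>(range C)} = (\<Union>n. {y \<in> space past_algebra. y i \<in> C n})"
        by auto
      then show ?case using un[OF Union.IH] by simp
    qed
  qed
  have "A \<in> sigma_sets (space past_algebra) {{y \<in> space past_algebra. y i \<in> C} | i C. i \<in> {..<0} \<and> C \<in> sets borel}"
    using A unfolding sets_PiM_single by (simp add: space_PiM)
  then have "A \<in> \<A>"
  proof induction
    case (Basic A)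
    then show ?case using cyl by auto
  qed (use compl un empty in auto)
  then show ?thesis by (simp add: \<A>_def)
qed

lemma block_approximable_integrable:
  assumes N: "sets N = sets past_algebra" and fin: "finite_measure N" and f: "integrable N f"
  shows "block_approximable N f"
  using f
proof induction
  case (base A c)
  have "block_approximable N (\<lambda>y. c * indicator A y)"
    using base by (intro block_approximable_scale block_approximable_set N fin) (simp add: N)
  then show ?case by (simp add: mult.commute)
next
  case (add f g)
  show ?case
    by (intro block_approximable_add add N)
next
  case (lim f s)
  show ?case
  proof (rule block_approximable_closed[OF lim(5,4)])
    have [measurable]: "f \<in> borel_measurable N" "s i \<in> borel_measurable N" for i using lim by auto
    have "(\<lambda>n. \<integral>y. \<bar>f y - s n y\<bar> \<partial>N) \<longlonglongrightarrow> (\<integral>y. (0::real) \<partial>N)"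
    proof (rule integral_dominated_convergence[where w = "\<lambda>y. 3 * \<bar>f y\<bar>"])
      show "AE y in N. (\<lambda>n. \<bar>f y - s n y\<bar>) \<longlonglongrightarrow> 0"
      proof (rule AE_I2)
        fix y assume "y \<in> space N"
        from tendsto_rabs_zero[OF Lim_null[THEN iffD1, OF lim(2)[OF this]]]
        show "(\<lambda>n. \<bar>f y - s n y\<bar>) \<longlonglongrightarrow> 0" by (simp add: abs_minus_commute)
      qed
      show "AE y in N. norm \<bar>f y - s n y\<bar> \<le> 3 * \<bar>f y\<bar>" for n
        using lim(3)[of _ n] by (intro AE_I2) (smt (verit) real_norm_def)
    qed (use lim(4) in auto)
    then show "(\<lambda>n. \<integral>y. \<bar>f y - s n y\<bar> \<partial>N) \<longlonglongrightarrow> 0" by simp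
  qed
qed

end

section \<open>Regular conditional distributions\<close>

lemma (in prob_space) abs_integral_le_bound:
  fixes f :: "'a \<Rightarrow> real"
  assumes [measurable]: "f \<in> borel_measurable M" and f: "\<And>x. x \<in> space M \<Longrightarrow> \<bar>f x\<bar> \<le> H"
  shows "\<bar>\<integral>x. f x \<partial>M\<bar> \<le> H"
proof -
  have "integrable M f"
    by (rule integrable_const_bound[where B = H]) (auto simp: f)
  then have "(\<integral>x. \<bar>f x\<bar> \<partial>M) \<le> H"
    by (intro integral_le_const) (auto simp: f)
  then show ?thesis
    using integral_abs_bound[of M f] by linarith
qed

lemma subalgebra_vimage_algebra:
  assumes Y: "Y \<in> M \<rightarrow>\<^sub>M T"
  shows "subalgebra M (vimage_algebra (space M) Y T)"
  unfolding subalgebra_def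
  using measurable_sets[OF Y] measurable_space[OF Y] by (auto simp: sets_vimage_algebra2)

text \<open>On an event \<open>C\<close> of the conditioning \<open>\<sigma>\<close>-algebra, the law of \<open>Z\<close> restricted to \<open>C\<close> is the
  mixture of the kernel over \<open>C\<close>: the two measures agree on every set by the defining property of the
  kernel, hence they integrate \<open>h\<close> to the same value.\<close>

lemma real_cond_exp_regular_cond_dist:
  fixes h :: "'b \<Rightarrow> real"
  assumes "prob_space M" and \<kappa>: "regular_cond_dist M S Z T Y \<kappa>"
    and Z [measurable]: "Z \<in> M \<rightarrow>\<^sub>M S" and Y [measurable]: "Y \<in> M \<rightarrow>\<^sub>M T"
    and h [measurable]: "h \<in> borel_measurable S" and h_le: "\<And>u. u \<in> space S \<Longrightarrow> \<bar>h u\<bar> \<le> H"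
  shows "AE \<omega> in M. real_cond_exp M (vimage_algebra (space M) Y T) (\<lambda>\<omega>. h (Z \<omega>)) \<omega> = (\<integral>u. h u \<partial>\<kappa> (Y \<omega>))"
proof -
  interpret prob_space M by fact
  let ?F = "vimage_algebra (space M) Y T"
  have sub: "subalgebra M ?F" by (rule subalgebra_vimage_algebra) fact
  interpret finite_measure_subalgebra M ?F
    by unfold_locales (rule sub)
  have Y_F [measurable]: "Y \<in> ?F \<rightarrow>\<^sub>M T"
    by (rule measurable_vimage_algebra1) (use measurable_space[OF Y] in auto)
  have \<kappa>_prob: "\<kappa> \<in> T \<rightarrow>\<^sub>M prob_algebra S" using \<kappa> by (simp add: regular_cond_dist_def)
  then have \<kappa>_meas [measurable]: "\<kappa> \<in> T \<rightarrow>\<^sub>M subprob_algebra S" by (rule measurable_prob_algebraD)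
  have \<kappa>_sp: "prob_space (\<kappa> y)" "sets (\<kappa> y) = sets S" if "y \<in> space T" for y
    using measurable_space[OF \<kappa>_prob that] by (auto simp: space_prob_algebra)
  define f where "f y = (\<integral>u. h u \<partial>\<kappa> y)" for y
  have [measurable]: "f \<in> borel_measurable T"
    unfolding f_def by (rule measurable_compose[OF \<kappa>_meas]) measurable
  have f_le: "\<bar>f y\<bar> \<le> H" if "y \<in> space T" for y
    unfolding f_def
    using prob_space.abs_integral_le_bound[OF \<kappa>_sp(1)[OF that], of h H] \<kappa>_sp(2)[OF that]
      sets_eq_imp_space_eq[OF \<kappa>_sp(2)[OF that]] h_le
    by (simp cong: measurable_cong_sets)
  have int_f: "integrable M (\<lambda>\<omega>. f (Y \<omega>))"
    by (rule integrable_const_bound[where B = H]) (auto intro!: f_le AE_I2 measurable_space[OF Y])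
  have int_h: "integrable M (\<lambda>\<omega>. h (Z \<omega>))"
    by (rule integrable_const_bound[where B = H]) (auto intro!: h_le AE_I2 measurable_space[OF Z])
  have "AE \<omega> in M. real_cond_exp M ?F (\<lambda>\<omega>. h (Z \<omega>)) \<omega> = f (Y \<omega>)"
  proof (rule real_cond_exp_charact[OF _ int_h int_f])
    show "(\<lambda>\<omega>. f (Y \<omega>)) \<in> borel_measurable ?F" by measurable
    fix C assume C_F: "C \<in> sets ?F"
    then have C [measurable]: "C \<in> sets M" using sub by (auto simp: subalgebra_def)
    define \<mu> where "\<mu> = density M (indicator C)"
    have sets_\<mu> [measurable_cong]: "sets \<mu> = sets M" and space_\<mu>: "space \<mu> = space M"
      by (simp_all add: \<mu>_def)
    have fin_\<mu>: "finite_measure \<mu>"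
      by (rule finite_measureI) (simp add: \<mu>_def emeasure_density emeasure_eq_measure)
    have int_\<mu>: "(\<integral>\<omega>\<in>C. u \<omega> \<partial>M) = (\<integral>\<omega>. u \<omega> \<partial>\<mu>)" if [measurable]: "u \<in> borel_measurable M" for u :: "'a \<Rightarrow> real"
      unfolding \<mu>_def set_lebesgue_integral_def
      using integral_density[of u M "indicator C"] by (simp add: ennreal_indicator)
    have "distr \<mu> S Z = \<mu> \<bind> (\<lambda>\<omega>. \<kappa> (Y \<omega>))"
    proof (rule measure_eqI)
      show "sets (distr \<mu> S Z) = sets (\<mu> \<bind> (\<lambda>\<omega>. \<kappa> (Y \<omega>)))"
        by (subst sets_bind[where N = S])
          (use not_empty \<kappa>_sp measurable_space[OF Y] in \<open>auto simp: space_\<mu>\<close>)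
      fix A assume "A \<in> sets (distr \<mu> S Z)"
      then have A [measurable]: "A \<in> sets S" by simp
      have "emeasure (distr \<mu> S Z) A = (\<integral>\<^sup>+\<omega>. indicator A (Z \<omega>) \<partial>\<mu>)"
        using nn_integral_distr[of Z \<mu> S "indicator A"] by simp
      also have "\<dots> = ennreal (\<integral>\<omega>. indicator A (Z \<omega>) \<partial>\<mu>)"
        by (subst nn_integral_eq_integral[symmetric])
          (auto intro!: finite_measure.integrable_const_bound[OF fin_\<mu>, where B = 1] simp: ennreal_indicator)
      also have "(\<integral>\<omega>. indicator A (Z \<omega>) \<partial>\<mu>) = (\<integral>\<omega>. measure (\<kappa> (Y \<omega>)) A \<partial>\<mu> :: real)"
      proof -
        have "(\<integral>\<omega>. indicator A (Z \<omega>) \<partial>\<mu>) = (\<integral>\<omega>\<in>C. indicator A (Z \<omega>) \<partial>M :: real)"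
          by (simp add: int_\<mu>)
        also have "\<dots> = (\<integral>\<omega>\<in>C. real_cond_exp M ?F (\<lambda>\<omega>. indicator A (Z \<omega>)) \<omega> \<partial>M)"
          by (rule real_cond_exp_intA[OF _ C_F]) (auto intro!: integrable_const_bound[where B = 1])
        also have "\<dots> = (\<integral>\<omega>\<in>C. measure (\<kappa> (Y \<omega>)) A \<partial>M)"
          unfolding set_lebesgue_integral_def
          by (rule integral_cong_AE) (use \<kappa> A in \<open>auto simp: regular_cond_dist_def elim!: ballE[of _ _ A]\<close>)
        also have "\<dots> = (\<integral>\<omega>. measure (\<kappa> (Y \<omega>)) A \<partial>\<mu>)"
          by (simp add: int_\<mu>)
        finally show ?thesis .
      qed
      also have "ennreal \<dots> = (\<integral>\<^sup>+\<omega>. ennreal (measure (\<kappa> (Y \<omega>)) A) \<partial>\<mu>)"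
        by (subst nn_integral_eq_integral)
          (auto intro!: finite_measure.integrable_const_bound[OF fin_\<mu>, where B = 1] AE_I2
            prob_space.prob_le_1 \<kappa>_sp measurable_space[OF Y] simp: space_\<mu>)
      also have "\<dots> = (\<integral>\<^sup>+\<omega>. emeasure (\<kappa> (Y \<omega>)) A \<partial>\<mu>)"
        by (intro nn_integral_cong finite_measure.emeasure_eq_measure[symmetric]
            prob_space.finite_measure \<kappa>_sp measurable_space[OF Y]) (simp add: space_\<mu>)
      also have "\<dots> = emeasure (\<mu> \<bind> (\<lambda>\<omega>. \<kappa> (Y \<omega>))) A"
        by (rule emeasure_bind[symmetric, where N = S]) (use not_empty in \<open>auto simp: space_\<mu>\<close>)
      finally show "emeasure (distr \<mu> S Z) A = emeasure (\<mu> \<bind> (\<lambda>\<omega>. \<kappa> (Y \<omega>))) A" .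
    qed
    then have "(\<integral>u. h u \<partial>distr \<mu> S Z) = (\<integral>u. h u \<partial>(\<mu> \<bind> (\<lambda>\<omega>. \<kappa> (Y \<omega>))))" by simp
    also have "\<dots> = (\<integral>\<omega>. f (Y \<omega>) \<partial>\<mu>)"
      unfolding f_def
    proof (rule integral_bind[where K = S and B = H and B' = 1])
      show "AE \<omega> in \<mu>. emeasure (\<kappa> (Y \<omega>)) (space (\<kappa> (Y \<omega>))) \<le> ennreal 1"
        using prob_space.emeasure_space_1[OF \<kappa>_sp(1)] measurable_space[OF Y]
        by (intro AE_I2) (simp add: space_\<mu>)
    qed (use h_le fin_\<mu> in auto)
    finally have "(\<integral>\<omega>. h (Z \<omega>) \<partial>\<mu>) = (\<integral>\<omega>. f (Y \<omega>) \<partial>\<mu>)"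
      by (simp add: integral_distr)
    then show "(\<integral>\<omega>\<in>C. h (Z \<omega>) \<partial>M) = (\<integral>\<omega>\<in>C. f (Y \<omega>) \<partial>M)"
      by (simp add: int_\<mu>)
  qed
  then show ?thesis by (simp add: f_def)
qed

lemma integral_residual_eq_0:
  fixes h :: "'b \<Rightarrow> real" and G :: "'c \<Rightarrow> real"
  assumes "prob_space M" and \<kappa>: "regular_cond_dist M S Z T Y \<kappa>"
    and Z [measurable]: "Z \<in> M \<rightarrow>\<^sub>M S" and Y [measurable]: "Y \<in> M \<rightarrow>\<^sub>M T"
    and h [measurable]: "h \<in> borel_measurable S" and h_le: "\<And>u. u \<in> space S \<Longrightarrow> \<bar>h u\<bar> \<le> H"
    and G [measurable]: "G \<in> borel_measurable T" and G_le: "\<And>y. y \<in> space T \<Longrightarrow> \<bar>G y\<bar> \<le> C"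
  shows "(\<integral>\<omega>. (h (Z \<omega>) - (\<integral>u. h u \<partial>\<kappa> (Y \<omega>))) * G (Y \<omega>) \<partial>M) = 0"
proof -
  interpret prob_space M by fact
  let ?F = "vimage_algebra (space M) Y T"
  have sub: "subalgebra M ?F" by (rule subalgebra_vimage_algebra) fact
  interpret finite_measure_subalgebra M ?F
    by unfold_locales (rule sub)
  have Y_F [measurable]: "Y \<in> ?F \<rightarrow>\<^sub>M T"
    by (rule measurable_vimage_algebra1) (use measurable_space[OF Y] in auto)
  let ?h = "\<lambda>\<omega>. h (Z \<omega>)"
  have int: "integrable M (\<lambda>\<omega>. G (Y \<omega>) * ?h \<omega>)"
  proof (rule integrable_const_bound[where B = "C * H"])
    show "AE \<omega> in M. norm (G (Y \<omega>) * ?h \<omega>) \<le> C * H"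
    proof (rule AE_I2)
      fix \<omega> assume "\<omega> \<in> space M"
      then have "\<bar>G (Y \<omega>)\<bar> \<le> C" "\<bar>?h \<omega>\<bar> \<le> H"
        using G_le h_le measurable_space[OF Y] measurable_space[OF Z] by auto
      then show "norm (G (Y \<omega>) * ?h \<omega>) \<le> C * H"
        unfolding real_norm_def abs_mult by (intro mult_mono) auto
    qed
  qed measurable
  have G_F: "(\<lambda>\<omega>. G (Y \<omega>)) \<in> borel_measurable ?F" by measurable
  have h_M: "?h \<in> borel_measurable M" by measurable
  note intg = real_cond_exp_intg[OF int G_F h_M]
  have "(\<integral>\<omega>. (?h \<omega> - (\<integral>u. h u \<partial>\<kappa> (Y \<omega>))) * G (Y \<omega>) \<partial>M) =
      (\<integral>\<omega>. G (Y \<omega>) * ?h \<omega> - G (Y \<omega>) * real_cond_exp M ?F ?h \<omega> \<partial>M)"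
  proof (rule integral_cong_AE)
    have "\<kappa> \<in> T \<rightarrow>\<^sub>M subprob_algebra S"
      using \<kappa> by (auto simp: regular_cond_dist_def intro: measurable_prob_algebraD)
    then have [measurable]: "(\<lambda>y. \<integral>u. h u \<partial>\<kappa> y) \<in> borel_measurable T"
      by (rule measurable_compose) measurable
    show "(\<lambda>\<omega>. (?h \<omega> - (\<integral>u. h u \<partial>\<kappa> (Y \<omega>))) * G (Y \<omega>)) \<in> borel_measurable M" by measurable
    show "AE \<omega> in M. (?h \<omega> - (\<integral>u. h u \<partial>\<kappa> (Y \<omega>))) * G (Y \<omega>) =
        G (Y \<omega>) * ?h \<omega> - G (Y \<omega>) * real_cond_exp M ?F ?h \<omega>"
    proof -
      have "AE \<omega> in M. real_cond_exp M ?F ?h \<omega> = (\<integral>u. h u \<partial>\<kappa> (Y \<omega>))"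
        by (rule real_cond_exp_regular_cond_dist[OF assms(1-5) h_le])
      then show ?thesis by eventually_elim (simp add: algebra_simps)
    qed
  qed measurable
  also have "\<dots> = 0" using intg int by simp
  finally show ?thesis .
qed

section \<open>Convergence of the empirical conditional means\<close>

text \<open>The empirical distribution is the law of the value at a uniformly chosen one of the \<open>J\<close>
  recurrences, so integrals against it are averages.\<close>

lemma integral_empirical_cond_dist:
  fixes h :: "real \<Rightarrow> real"
  assumes [measurable]: "h \<in> borel_measurable borel" and "J > 0"
  shows "(\<integral>u. h u \<partial>empirical_cond_dist B l J x) =
    1 / real J * (\<Sum>j=1..J. h (x (- int (recurrence_time B l x j))))"
proof -
  let ?U = "uniform_count_measure {1..J}" and ?v = "\<lambda>j. x (- int (recurrence_time B l x j))"
  have v [measurable]: "?v \<in> ?U \<rightarrow>\<^sub>M borel"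
    by (rule measurableI) (auto simp: space_uniform_count_measure sets_uniform_count_measure)
  have "empirical_cond_dist B l J x = distr ?U borel ?v"
  proof (rule measure_eqI)
    fix A assume "A \<in> sets (empirical_cond_dist B l J x)"
    then have A [measurable]: "A \<in> sets borel" by simp
    have "emeasure (distr ?U borel ?v) A = emeasure ?U {j \<in> {1..J}. ?v j \<in> A}"
      by (subst emeasure_distr[OF v A]) (auto simp: space_uniform_count_measure intro!: arg_cong2[where f = emeasure])
    also have "\<dots> = ennreal (1 / real J) * of_nat (card {j \<in> {1..J}. ?v j \<in> A})"
    proof -
      have "emeasure ?U {j \<in> {1..J}. ?v j \<in> A} = ennreal (real (card {j \<in> {1..J}. ?v j \<in> A}) / real J)"
        by (subst emeasure_uniform_count_measure) auto
      also have "\<dots> = ennreal (1 / real J) * ennreal (real (card {j \<in> {1..J}. ?v j \<in> A}))"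
        by (subst ennreal_mult''[symmetric]) simp_all
      finally show ?thesis by (simp only: ennreal_of_nat_eq_real_of_nat)
    qed
    also have "of_nat (card {j \<in> {1..J}. ?v j \<in> A}) = (\<Sum>j=1..J. emeasure (return borel (?v j)) A)"
      by (simp add: indicator_def sum.If_cases Int_def)
    finally show "emeasure (empirical_cond_dist B l J x) A = emeasure (distr ?U borel ?v) A"
      by (simp add: emeasure_empirical_cond_dist[OF A])
  qed simp
  then show ?thesis
    by (simp add: integral_distr[OF v assms(1), simplified] integral_uniform_count_measure)
qed

lemma measurable_past [measurable]:
  assumes "\<And>t. X t \<in> borel_measurable M"
  shows "past X \<in> M \<rightarrow>\<^sub>M past_algebra"
  unfolding past_def using assms by (intro measurable_restrict) auto

lemma filterlim_at_top_mono_unbounded: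
  fixes J :: "nat \<Rightarrow> nat"
  assumes "mono_on {1..} J" "\<not> bdd_above (J ` {1..})"
  shows "filterlim J at_top sequentially"
  unfolding filterlim_at_top eventually_sequentially
proof
  fix Z
  obtain m where "m \<ge> 1" "Z < J m"
    using assms(2) unfolding bdd_above_def by (auto simp: not_le)
  then show "\<exists>N. \<forall>n\<ge>N. Z \<le> J n"
    using mono_onD[OF assms(1), of m] by (intro exI[of _ m] allI impI) force
qed

theorem mainTheorem2:
  fixes M :: "'a measure"
    and X :: "int \<Rightarrow> 'a \<Rightarrow> real"
    and \<kappa> :: "(int \<Rightarrow> real) \<Rightarrow> real measure"
    and B :: "nat \<Rightarrow> real set set"
    and l J :: "nat \<Rightarrow> nat"
    and h :: "real \<Rightarrow> real"
  assumes "prob_space M"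
    and "\<And>t. X t \<in> borel_measurable M"
    and "stationary M X"
    and "regular_cond_dist M borel (X 0) past_algebra (past X) \<kappa>"
    and "\<And>k. k \<ge> 1 \<Longrightarrow> algebra UNIV (B k) \<and> finite (B k) \<and> B k \<subseteq> sets borel"
    and "\<And>k. k \<ge> 1 \<Longrightarrow> \<exists>G. (\<forall>I\<in>G. is_interval I) \<and> B k = sigma_sets UNIV G"
    and "\<And>k. k \<ge> 1 \<Longrightarrow> B k \<subseteq> B (Suc k)"
    and "sigma_sets UNIV (\<Union>k\<in>{1..}. B k) = sets borel"
    and "\<And>k. k \<ge> 1 \<Longrightarrow> l k > 0" and "mono_on {1..} l" and "\<not> bdd_above (l ` {1..})"
    and "\<And>k. k \<ge> 1 \<Longrightarrow> J k > 0" and "mono_on {1..} J" and "\<not> bdd_above (J ` {1..})"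
    and "continuous_on UNIV h" and "bounded (range h)"
  shows "(\<forall>k\<ge>1. integrable M
            (\<lambda>\<omega>. \<integral>x. h x \<partial>empirical_cond_dist (B k) (l k) (J k) (\<lambda>t. X t \<omega>))) \<and>
         integrable M (\<lambda>\<omega>. \<integral>x. h x \<partial>\<kappa> (past X \<omega>)) \<and>
         (\<lambda>k. \<integral>\<omega>. \<bar>(\<integral>x. h x \<partial>empirical_cond_dist (B k) (l k) (J k) (\<lambda>t. X t \<omega>)) -
                    (\<integral>x. h x \<partial>\<kappa> (past X \<omega>))\<bar> \<partial>M) \<longlonglongrightarrow> 0"
proof -
  interpret M: prob_space M by fact
  note [measurable] = assms(2)
  let ?path = "\<lambda>\<omega> t. X t \<omega>"
  define Q where "Q = distr M paths ?path"
  have path [measurable]: "?path \<in> M \<rightarrow>\<^sub>M paths"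
    by (rule measurable_PiM_single') auto
  have past_eq: "past X \<omega> = past_of (?path \<omega>)" for \<omega>
    by (simp add: past_def)
  have past_meas [measurable]: "past X \<in> M \<rightarrow>\<^sub>M past_algebra"
    by (rule measurable_past) fact
  have sets_Q [measurable_cong]: "sets Q = sets paths" by (simp add: Q_def)
  have prob_Q: "prob_space Q" unfolding Q_def by (rule M.prob_space_distr) measurable
  interpret Q: prob_space Q by fact
  have distr_Q: "distr Q paths (time_shift s) = Q" for s
  proof -
    have "distr Q paths (time_shift s) = distr M paths (\<lambda>\<omega> t. X (t + - s) \<omega>)"
      unfolding Q_def by (subst distr_distr) (auto simp: comp_def time_shift_def)
    also have "\<dots> = Q"
      using assms(3) unfolding stationary_def Q_def by blast
    finally show ?thesis .
  qed
  obtain H where H: "\<bar>h u\<bar> \<le> H" for u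
    using \<open>bounded (range h)\<close> by (auto simp: bounded_iff)
  have h [measurable]: "h \<in> borel_measurable borel"
    by (rule borel_measurable_continuous_onI) fact
  define F where "F y = (\<integral>u. h u \<partial>\<kappa> y)" for y
  have \<kappa>: "\<kappa> \<in> past_algebra \<rightarrow>\<^sub>M prob_algebra borel"
    using assms(4) by (simp add: regular_cond_dist_def)
  have F [measurable]: "F \<in> borel_measurable past_algebra"
    unfolding F_def by (rule measurable_compose[OF measurable_prob_algebraD[OF \<kappa>]]) measurable
  have F_le: "\<bar>F y\<bar> \<le> H" if "y \<in> space past_algebra" for y
  proof -
    have *: "prob_space (\<kappa> y)" "sets (\<kappa> y) = sets borel"
      using measurable_space[OF \<kappa> that] by (auto simp: space_prob_algebra)
    show ?thesis
      unfolding F_def by (rule prob_space.abs_integral_le_bound[OF *(1)])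
        (use H in \<open>auto cong: measurable_cong_sets[OF *(2) refl]\<close>)
  qed
  have orth: "(\<integral>x. (h (x 0) - F (past_of x)) * G (past_of x) \<partial>Q) = 0"
    if G [measurable]: "G \<in> borel_measurable past_algebra" and G_le: "\<And>y. y \<in> space past_algebra \<Longrightarrow> \<bar>G y\<bar> \<le> C"
    for G C
  proof -
    have "(\<integral>x. (h (x 0) - F (past_of x)) * G (past_of x) \<partial>Q) =
        (\<integral>\<omega>. (h (X 0 \<omega>) - (\<integral>u. h u \<partial>\<kappa> (past X \<omega>))) * G (past X \<omega>) \<partial>M)"
      unfolding Q_def by (subst integral_distr) (simp_all add: past_eq F_def[symmetric])
    also have "\<dots> = 0"
      by (rule integral_residual_eq_0[OF assms(1,4) _ past_meas h H G G_le]) measurable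
    finally show ?thesis .
  qed
  let ?emp = "\<lambda>k x. 1 / real (J k) * (\<Sum>j=1..J k. h (x (- int (recurrence_time (B k) (l k) x j))))"
  have emp: "(\<integral>x. h x \<partial>empirical_cond_dist (B k) (l k) (J k) (\<lambda>t. X t \<omega>)) = ?emp k (?path \<omega>)"
    if "k \<ge> 1" for k \<omega>
    using assms(12)[OF that] by (simp add: integral_empirical_cond_dist)
  have law: "quantized_stationary_law Q (B k)" if "k \<ge> 1" for k
    using assms(5)[OF that] prob_Q sets_Q distr_Q
    by (auto simp: quantized_stationary_law_def quantized_stationary_law_axioms_def)
  have emp_meas [measurable]: "?emp k \<in> borel_measurable paths" if "k \<ge> 1" for k
  proof -
    interpret quantized_stationary_law Q "B k" "l k" by (rule law[OF that])
    show ?thesis by measurable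
  qed
  have int_emp: "integrable M (\<lambda>\<omega>. ?emp k (?path \<omega>))" if "k \<ge> 1" for k
  proof (rule M.integrable_const_bound[where B = H])
    show "AE \<omega> in M. norm (?emp k (?path \<omega>)) \<le> H"
    proof (rule AE_I2)
      fix \<omega>
      have "\<bar>\<Sum>j=1..J k. h (X (- int (recurrence_time (B k) (l k) (?path \<omega>) j)) \<omega>)\<bar> \<le> (\<Sum>j=1..J k. H)"
        by (intro order_trans[OF sum_abs] sum_mono H)
      then show "norm (?emp k (?path \<omega>)) \<le> H"
        using assms(12)[OF that] by (simp add: abs_mult field_simps)
    qed
    show "(\<lambda>\<omega>. ?emp k (?path \<omega>)) \<in> borel_measurable M"
      using measurable_compose[OF path emp_meas[OF that]] .
  qed
  have int_F: "integrable M (\<lambda>\<omega>. F (past X \<omega>))"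
    by (rule M.integrable_const_bound[where B = H])
      (auto intro!: AE_I2 F_le measurable_space[OF past_meas])
  have error_eq: "(\<integral>\<omega>. \<bar>(\<integral>x. h x \<partial>empirical_cond_dist (B k) (l k) (J k) (\<lambda>t. X t \<omega>)) -
      (\<integral>x. h x \<partial>\<kappa> (past X \<omega>))\<bar> \<partial>M) = (\<integral>x. \<bar>?emp k x - F (past_of x)\<bar> \<partial>Q)" if "k \<ge> 1" for k
  proof -
    note [measurable] = emp_meas[OF that]
    have "(\<lambda>x. \<bar>?emp k x - F (past_of x)\<bar>) \<in> borel_measurable paths" by measurable
    then show ?thesis
      unfolding Q_def emp[OF that] F_def[symmetric] past_eq by (rule integral_distr[OF path, symmetric])
  qed
  define N where "N = distr Q past_algebra past_of"
  have N: "sets N = sets past_algebra" by (simp add: N_def)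
  have fin_N: "finite_measure N"
    unfolding N_def by (rule Q.finite_measure_distr) measurable
  have int_Q: "integrable Q (\<lambda>x. u (past_of x))" "(\<integral>x. u (past_of x) \<partial>Q) = (\<integral>y. u y \<partial>N)"
    if "integrable N u" for u :: "_ \<Rightarrow> real"
  proof -
    have [measurable]: "u \<in> borel_measurable past_algebra"
      using that N by (auto cong: measurable_cong_sets dest: borel_measurable_integrable)
    show "integrable Q (\<lambda>x. u (past_of x))"
      using that unfolding N_def by (subst (asm) integrable_distr_eq) auto
    show "(\<integral>x. u (past_of x) \<partial>Q) = (\<integral>y. u y \<partial>N)"
      unfolding N_def by (subst integral_distr) auto
  qed
  interpret R: refining_quantizers B l
  proof (rule refining_quantizers.intro)
    fix k :: nat assume "1 \<le> k"
    then show "algebra UNIV (B k)" "finite (B k)" "B k \<subseteq> B (Suc k)"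
      using assms(5,7)[of k] by blast+
  qed (fact assms)+
  have "integrable N F"
    by (rule finite_measure.integrable_const_bound[OF fin_N, where B = H])
      (auto simp: N_def intro!: AE_I2 F_le)
  then have F_approx: "R.block_approximable N F"
    by (rule R.block_approximable_integrable[OF N fin_N])
  have lim: "(\<lambda>k. \<integral>x. \<bar>?emp k x - F (past_of x)\<bar> \<partial>Q) \<longlonglongrightarrow> 0"
  proof (rule LIMSEQ_I)
    fix e :: real assume "e > 0"
    \<comment> \<open>The bias costs at most twice the error of \<open>g\<close>, which leaves \<open>e / 2\<close> for the noise.\<close>
    then obtain m g where m: "m \<ge> 1" and g: "R.block_function m g" and int_g: "integrable N g"
      and g_e: "(\<integral>y. \<bar>F y - g y\<bar> \<partial>N) < e / 4"
      using F_approx unfolding R.block_approximable_def by (meson zero_less_divide_iff zero_less_numeral)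
    have "(\<lambda>k. 2 * H / sqrt (real (J k))) \<longlonglongrightarrow> 0"
    proof (rule tendsto_divide_0[OF tendsto_const])
      have "filterlim (\<lambda>k. sqrt (real (J k))) at_top sequentially"
        by (rule filterlim_compose[OF sqrt_at_top]
            filterlim_compose[OF filterlim_real_sequentially]
            filterlim_at_top_mono_unbounded assms(13,14))+
      then show "filterlim (\<lambda>k. sqrt (real (J k))) at_infinity sequentially"
        by (rule filterlim_at_top_imp_at_infinity)
    qed
    then have "eventually (\<lambda>k. 2 * H / sqrt (real (J k)) < e / 2) sequentially"
      using \<open>e > 0\<close> by (intro order_tendstoD) auto
    then have "eventually (\<lambda>k. norm ((\<integral>x. \<bar>?emp k x - F (past_of x)\<bar> \<partial>Q) - 0) < e) sequentially"
      using eventually_ge_at_top[of m]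
    proof eventually_elim
      case (elim k)
      then have k: "k \<ge> 1" "m \<le> k" using m by auto
      interpret L: quantized_stationary_law Q "B k" "l k" by (rule law[OF k(1)])
      have gk: "R.block_function k g" using R.block_function_mono[OF g m k(2)] .
      have "(\<integral>x. \<bar>?emp k x - F (past_of x)\<bar> \<partial>Q)
          \<le> 2 * H / sqrt (J k) + 2 * (\<integral>x. \<bar>F (past_of x) - g (past_of x)\<bar> \<partial>Q)"
      proof (rule L.integral_recurrence_mean_le[OF h H F F_le orth])
        show "g \<in> borel_measurable past_algebra" using gk by (simp add: R.block_function_def)
        show "integrable Q (\<lambda>x. g (past_of x))" by (rule int_Q[OF int_g])
        show "g (past_of y) = g (past_of z)"
          if "quantized_block (B k) (l k) y 0 = quantized_block (B k) (l k) z 0" for y z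
          using gk that by (auto simp: R.block_function_def space_PiM)
        show "J k > 0" by (rule assms(12)[OF k(1)])
      qed
      also have "(\<integral>x. \<bar>F (past_of x) - g (past_of x)\<bar> \<partial>Q) = (\<integral>y. \<bar>F y - g y\<bar> \<partial>N)"
        by (rule int_Q) (use \<open>integrable N F\<close> int_g in auto)
      finally have "(\<integral>x. \<bar>?emp k x - F (past_of x)\<bar> \<partial>Q) < e" using elim(1) g_e by linarith
      moreover have "0 \<le> (\<integral>x. \<bar>?emp k x - F (past_of x)\<bar> \<partial>Q)"
        by (rule Bochner_Integration.integral_nonneg) (rule abs_ge_zero)
      ultimately show ?case unfolding real_norm_def by linarith
    qed
    then show "\<exists>n0. \<forall>k\<ge>n0. norm ((\<integral>x. \<bar>?emp k x - F (past_of x)\<bar> \<partial>Q) - 0) < e"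
      by (simp add: eventually_sequentially)
  qed
  show ?thesis
  proof (intro conjI allI impI)
    show "integrable M (\<lambda>\<omega>. \<integral>x. h x \<partial>empirical_cond_dist (B k) (l k) (J k) (\<lambda>t. X t \<omega>))" if "1 \<le> k" for k
      unfolding emp[OF that] by (rule int_emp[OF that])
    show "integrable M (\<lambda>\<omega>. \<integral>x. h x \<partial>\<kappa> (past X \<omega>))"
      using int_F by (simp add: F_def)
    show "(\<lambda>k. \<integral>\<omega>. \<bar>(\<integral>x. h x \<partial>empirical_cond_dist (B k) (l k) (J k) (\<lambda>t. X t \<omega>)) -
        (\<integral>x. h x \<partial>\<kappa> (past X \<omega>))\<bar> \<partial>M) \<longlonglongrightarrow> 0"
      by (rule Lim_transform_eventually[OF lim], rule eventually_mono[OF eventually_ge_at_top[of 1]])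
        (simp only: error_eq)
  qed
qed

end
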